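(* Lagrangians $$L^{ij}=\tfrac12\alpha^{ij}(u_{ij}-u)^2+\beta^{ij}(u_{ij}-u)(u_i-u_j)+\tfrac12\gamma^{ij}(u_i-u_j)^2$$ assigned to oriented plaquettes $\sigma^{ij}(n)=(n,n+e_i,n+e_i+e_j,n+e_j)$ in $\mathbb Z^N$ are consistent, i.e. form a pluri-Lagrangian system, if and only if their coefficients satisfy $$\lambda-\mu(-1)^{|n|}\beta^{ij}+\nu\big((\beta^{ij})^2-\alpha^{ij}\gamma^{ij}\big)=0$$ for some fixed triple $(\lambda,\mu,\nu)\neq(0,0,0)$, where $|n|=n_1+\dots+n_N$, and their evolution is expressed (in the generic case, when $\lambda,\nu\neq0$) through a solution of the coupled star-triangle relations $$\frac{1}{p^{ij}_k}=\frac{\lambda}{\nu}\cdot\frac{q^{ij}q^{jk}+q^{jk}q^{ki}+q^{ki}q^{ij}}{q^{ij}},\qquad \frac{1}{q^{ij}_k}=\frac{\lambda}{\nu}\cdot\frac{p^{ij}p^{jk}+p^{jk}p^{ki}+p^{ki}p^{ij}}{p^{ij}}$$ via the following relations: $$p^{ij}=\frac{1-\xi\beta^{ij}}{\alpha^{ij}},\qquad q^{ij}=\frac{1-\eta\beta^{ij}}{\alpha^{ij}},$$ and $$p^{ij}_k=\frac{1+\xi\beta^{ij}_k}{\alpha^{ij}_k},\qquad q^{ij}_k=\frac{1+\eta\beta^{ij}_k}{\alpha^{ij}_k},$$ where $-\xi$, $-\eta$ are the two roots $x$ of the quadratic equation $\lambda x^2+\mu x+\nu=0$.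
   Context: Notation on the lattice: $n=(n_1,\dots,n_N)\in\mathbb Z^N$, $e_i$ is the $i$-th coordinate vector, $T_i:n\mapsto n+e_i$ is the lattice shift, $I$ is the identity. Subscripts on the field $u$ denote shifts: $u=u(n)$, $u_i=u(n+e_i)$, $u_{ij}=u(n+e_i+e_j)$, etc. Quantities with double superscript $ij$ are attached to the plaquette $\sigma^{ij}(n)$ and depend on the plaquette; an additional subscript $k$ means that the quantity is attached to the shifted plaquette $\sigma^{ij}(n+e_k)$, so that $\alpha^{ij}_k,\beta^{ij}_k$ are coefficients of the Lagrangian on $\sigma^{ij}(n+e_k)$. The Lagrangians form a discrete 2-form, i.e. $L^{ji}=-L^{ij}$. Consistency. For an elementary cube with base point $n$ and distinct directions $i,j,k$, put $$S^{ijk}=(T_k-I)L^{ij}+(T_i-I)L^{jk}+(T_j-I)L^{ki},$$ a function of the eight fields $u,u_i,u_j,u_k,u_{ij},u_{jk},u_{ik},u_{ijk}$ at the vertices of the cube. The eight corner equations are $\partial S^{ijk}/\partial w=0$, where $w$ runs over these eight fields; here they are linear. The Lagrangians are called consistent if for every elementary cube the system of eight corner equations has the minimal possible rank $2$, i.e. exactly two of the equations are linearly independent. Evolution means the map which sends the coefficients on the three plaquettes $\sigma^{ij}(n),\sigma^{jk}(n),\sigma^{ki}(n)$ of an elementary cube to the coefficients on the three opposite plaquettes $\sigma^{ij}(n+e_k),\sigma^{jk}(n+e_i),\sigma^{ki}(n+e_j)$; the formulas are to be read with all cyclic permutations of $(i,j,k)$.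
   Formalization: In "only if" the triple is fixed per cube and kept by the evolution, not one for the whole lattice; in the formulas for p, q, β is replaced by (-1)^{|n|}β; α, p, q are nonzero in the generic case; ξ≠η is assumed where star-triangle relations imply consistency. *)

theory Defs
  imports "HOL-Analysis.Analysis" "HOL-Library.Function_Algebras"
begin

text \<open>
  The lattice is \<open>int ^ 'n\<close>, so \<open>N\<close> is the cardinality of the finite type \<open>'n\<close>, whose elements are
  the coordinate directions. A quantity carrying indices \<open>ij\<close> and attached to the plaquette at \<open>n\<close>
  is a function of \<open>n i j\<close>; its values for \<open>i = j\<close> are never used. The scalars form a
  \<^class>\<open>real_normed_field\<close>, which covers both \<open>real\<close> and \<open>complex\<close>.
\<close>

definition unit_shift :: "'n::finite \<Rightarrow> int ^ 'n" where
  "unit_shift i = axis i 1"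

definition parity_sign :: "int ^ 'n::finite \<Rightarrow> 'a::field" where
  "parity_sign n = (-1) powi (\<Sum>i\<in>UNIV. n $ i)"

definition lagrangian ::
  "(int ^ 'n \<Rightarrow> 'n \<Rightarrow> 'n \<Rightarrow> 'a) \<Rightarrow> (int ^ 'n \<Rightarrow> 'n \<Rightarrow> 'n \<Rightarrow> 'a) \<Rightarrow> (int ^ 'n \<Rightarrow> 'n \<Rightarrow> 'n \<Rightarrow> 'a) \<Rightarrow>
    (int ^ 'n \<Rightarrow> 'a) \<Rightarrow> int ^ 'n::finite \<Rightarrow> 'n \<Rightarrow> 'n \<Rightarrow> 'a::field" where
  "lagrangian \<alpha> \<beta> \<gamma> u n i j =
     (let d = u (n + unit_shift i + unit_shift j) - u n;
          d' = u (n + unit_shift i) - u (n + unit_shift j)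
      in 1/2 * \<alpha> n i j * d\<^sup>2 + \<beta> n i j * d * d' + 1/2 * \<gamma> n i j * d'\<^sup>2)"

definition discrete_2form ::
  "((int ^ 'n \<Rightarrow> 'a) \<Rightarrow> int ^ 'n::finite \<Rightarrow> 'n \<Rightarrow> 'n \<Rightarrow> 'a::field) \<Rightarrow> bool" where
  "discrete_2form L \<longleftrightarrow> (\<forall>u n i j. i \<noteq> j \<longrightarrow> L u n j i = - L u n i j)"

definition cube_action ::
  "((int ^ 'n \<Rightarrow> 'a) \<Rightarrow> int ^ 'n::finite \<Rightarrow> 'n \<Rightarrow> 'n \<Rightarrow> 'a::field) \<Rightarrow>
    int ^ 'n \<Rightarrow> 'n \<Rightarrow> 'n \<Rightarrow> 'n \<Rightarrow> (int ^ 'n \<Rightarrow> 'a) \<Rightarrow> 'a" where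
  "cube_action L n i j k u =
     (L u (n + unit_shift k) i j - L u n i j)
   + (L u (n + unit_shift i) j k - L u n j k)
   + (L u (n + unit_shift j) k i - L u n k i)"

definition cube_vertices :: "int ^ 'n::finite \<Rightarrow> 'n \<Rightarrow> 'n \<Rightarrow> 'n \<Rightarrow> (int ^ 'n) set" where
  "cube_vertices n i j k =
     {n, n + unit_shift i, n + unit_shift j, n + unit_shift k,
      n + unit_shift i + unit_shift j, n + unit_shift j + unit_shift k,
      n + unit_shift i + unit_shift k, n + unit_shift i + unit_shift j + unit_shift k}"

text \<open>The left-hand side of the corner equation at the vertex \<open>w\<close>, as a function of the field.\<close>

definition corner_lhs ::
  "((int ^ 'n \<Rightarrow> 'a) \<Rightarrow> int ^ 'n::finite \<Rightarrow> 'n \<Rightarrow> 'n \<Rightarrow> 'a::real_normed_field) \<Rightarrow>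
    int ^ 'n \<Rightarrow> 'n \<Rightarrow> 'n \<Rightarrow> 'n \<Rightarrow> int ^ 'n \<Rightarrow> (int ^ 'n \<Rightarrow> 'a) \<Rightarrow> 'a" where
  "corner_lhs L n i j k w u = deriv (\<lambda>t. cube_action L n i j k (u(w := t))) (u w)"

text \<open>
  For a quadratic Lagrangian the corner equations are linear homogeneous, so the rank of the system
  is the dimension of the span of its left-hand sides in the space of functions of the field.
\<close>

definition corner_rank ::
  "((int ^ 'n \<Rightarrow> 'a) \<Rightarrow> int ^ 'n::finite \<Rightarrow> 'n \<Rightarrow> 'n \<Rightarrow> 'a::real_normed_field) \<Rightarrow>
    int ^ 'n \<Rightarrow> 'n \<Rightarrow> 'n \<Rightarrow> 'n \<Rightarrow> nat" where
  "corner_rank L n i j k =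
     vector_space.dim (\<lambda>c (f :: (int ^ 'n \<Rightarrow> 'a) \<Rightarrow> 'a) u. c * f u)
       (corner_lhs L n i j k ` cube_vertices n i j k)"

definition consistent ::
  "((int ^ 'n \<Rightarrow> 'a) \<Rightarrow> int ^ 'n::finite \<Rightarrow> 'n \<Rightarrow> 'n \<Rightarrow> 'a::real_normed_field) \<Rightarrow> bool" where
  "consistent L \<longleftrightarrow> (\<forall>n i j k. distinct [i, j, k] \<longrightarrow> corner_rank L n i j k = 2)"

definition base_plaquettes ::
  "int ^ 'n::finite \<Rightarrow> 'n \<Rightarrow> 'n \<Rightarrow> 'n \<Rightarrow> ((int ^ 'n) \<times> 'n \<times> 'n) set" where
  "base_plaquettes n i j k = {(n, i, j), (n, j, k), (n, k, i)}"

definition opposite_plaquettes ::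
  "int ^ 'n::finite \<Rightarrow> 'n \<Rightarrow> 'n \<Rightarrow> 'n \<Rightarrow> ((int ^ 'n) \<times> 'n \<times> 'n) set" where
  "opposite_plaquettes n i j k =
     {(n + unit_shift k, i, j), (n + unit_shift i, j, k), (n + unit_shift j, k, i)}"

definition cube_plaquettes ::
  "int ^ 'n::finite \<Rightarrow> 'n \<Rightarrow> 'n \<Rightarrow> 'n \<Rightarrow> ((int ^ 'n) \<times> 'n \<times> 'n) set" where
  "cube_plaquettes n i j k = base_plaquettes n i j k \<union> opposite_plaquettes n i j k"

definition coeff_constraint ::
  "(int ^ 'n \<Rightarrow> 'n \<Rightarrow> 'n \<Rightarrow> 'a) \<Rightarrow> (int ^ 'n \<Rightarrow> 'n \<Rightarrow> 'n \<Rightarrow> 'a) \<Rightarrow> (int ^ 'n \<Rightarrow> 'n \<Rightarrow> 'n \<Rightarrow> 'a) \<Rightarrow>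
    'a::field \<Rightarrow> 'a \<Rightarrow> 'a \<Rightarrow> (int ^ 'n::finite) \<times> 'n \<times> 'n \<Rightarrow> bool" where
  "coeff_constraint \<alpha> \<beta> \<gamma> lam \<mu> \<nu> = (\<lambda>(n, i, j).
     lam - \<mu> * parity_sign n * \<beta> n i j + \<nu> * ((\<beta> n i j)\<^sup>2 - \<alpha> n i j * \<gamma> n i j) = 0)"

text \<open>Equality of polynomials, so a double root is listed twice.\<close>

definition quadratic_roots :: "'a::field \<Rightarrow> 'a \<Rightarrow> 'a \<Rightarrow> 'a \<Rightarrow> 'a \<Rightarrow> bool" where
  "quadratic_roots a b c r s \<longleftrightarrow> (\<forall>x. a * x\<^sup>2 + b * x + c = a * (x - r) * (x - s))"

text \<open>
  The quantities \<open>p\<close> (for \<open>x = \<xi>\<close>) and \<open>q\<close> (for \<open>x = \<eta>\<close>). On a cube with an even base point the formula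
  reads \<open>(1 - x \<beta>) / \<alpha>\<close> on the base plaquettes and \<open>(1 + x \<beta>) / \<alpha>\<close> on the opposite ones. On a cube
  with an odd base point the sign of \<open>\<beta>\<close> is reversed, as it is in \<^const>\<open>coeff_constraint\<close>.
\<close>

definition star_param ::
  "(int ^ 'n \<Rightarrow> 'n \<Rightarrow> 'n \<Rightarrow> 'a) \<Rightarrow> (int ^ 'n \<Rightarrow> 'n \<Rightarrow> 'n \<Rightarrow> 'a) \<Rightarrow> 'a::field \<Rightarrow>
    int ^ 'n::finite \<Rightarrow> 'n \<Rightarrow> 'n \<Rightarrow> 'a" where
  "star_param \<alpha> \<beta> x n i j = (1 - parity_sign n * x * \<beta> n i j) / \<alpha> n i j"

definition star_triangle_at ::
  "'a::field \<Rightarrow> (int ^ 'n \<Rightarrow> 'n \<Rightarrow> 'n \<Rightarrow> 'a) \<Rightarrow> (int ^ 'n \<Rightarrow> 'n \<Rightarrow> 'n \<Rightarrow> 'a) \<Rightarrow>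
    int ^ 'n::finite \<Rightarrow> 'n \<Rightarrow> 'n \<Rightarrow> 'n \<Rightarrow> bool" where
  "star_triangle_at c p q n i j k \<longleftrightarrow>
     1 / p (n + unit_shift k) i j =
       c * ((q n i j * q n j k + q n j k * q n k i + q n k i * q n i j) / q n i j)"

definition coupled_star_triangle ::
  "'a::field \<Rightarrow> (int ^ 'n \<Rightarrow> 'n \<Rightarrow> 'n \<Rightarrow> 'a) \<Rightarrow> (int ^ 'n \<Rightarrow> 'n \<Rightarrow> 'n \<Rightarrow> 'a) \<Rightarrow>
    int ^ 'n::finite \<Rightarrow> 'n \<Rightarrow> 'n \<Rightarrow> 'n \<Rightarrow> bool" where
  "coupled_star_triangle c p q n i j k \<longleftrightarrow>
     (\<forall>(i', j', k') \<in> {(i, j, k), (j, k, i), (k, i, j)}.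
        star_triangle_at c p q n i' j' k' \<and> star_triangle_at c q p n i' j' k')"

text \<open>
  The denominators in the star-triangle relations and in the formulas for \<open>p\<close> and \<open>q\<close> do not vanish.
\<close>

definition nondegenerate ::
  "(int ^ 'n \<Rightarrow> 'n \<Rightarrow> 'n \<Rightarrow> 'a) \<Rightarrow> (int ^ 'n \<Rightarrow> 'n \<Rightarrow> 'n \<Rightarrow> 'a) \<Rightarrow> 'a::field \<Rightarrow> 'a \<Rightarrow>
    (int ^ 'n::finite) \<times> 'n \<times> 'n \<Rightarrow> bool" where
  "nondegenerate \<alpha> \<beta> \<xi> \<eta> = (\<lambda>(n, i, j).
     \<alpha> n i j \<noteq> 0 \<and> star_param \<alpha> \<beta> \<xi> n i j \<noteq> 0 \<and> star_param \<alpha> \<beta> \<eta> n i j \<noteq> 0)"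

end

theory Submission
  imports Defs
begin

text \<open>
  The action on a cube is a quadratic form in the eight fields, and the corner equations are the rows
  of its Hessian, so a rank of at most 2 means that all 3x3 minors of the Hessian vanish.
  Take a cube with an even base point; an odd one only changes the sign of \<open>\<beta>\<close>. Put
  \<open>t = -\<beta>\<close> on the base plaquettes, \<open>t = \<beta>\<close> on the opposite ones, and \<open>d = \<beta>\<^sup>2 - \<alpha>\<gamma>\<close>. The existence of a
  common triple (\<open>\<lambda>\<close>, \<open>\<mu>\<close>, \<open>\<nu>\<close>) says that the six points (t, d) lie on a line. For any three of them the
  determinant testing this is a sum or difference of two 3x3 minors of the Hessian. Likewise the star-triangle
  relation, after clearing denominators, is a polynomial combination of three minors and of the
  quadratic constraints.

  Conversely, let \<open>x = 1/\<xi>\<close>, \<open>y = 1/\<eta>\<close>, \<open>p = (x - \<beta>)/\<alpha>\<close>, \<open>q = (y - \<beta>)/\<alpha>\<close> on the base plaquettes and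
  \<open>P = (x + \<beta>)/\<alpha>\<close>, \<open>Q = (y + \<beta>)/\<alpha>\<close> on the opposite ones. The star-triangle relations are the 3D
  consistency conditions of the discrete Moutard equations with coefficients (p, Q) and (q, P): those
  equations hold on two-parameter families of fields, and all corner equations hold on these fields.
  If \<open>\<xi> \<noteq> \<eta>\<close>, the two families together span enough of the kernel to force rank 2.
\<close>

section \<open>Rank of a finite family of functions\<close>

lemma vector_space_funs: "vector_space (\<lambda>c (f :: 'b \<Rightarrow> 'a::field) u. c * f u)"
  by unfold_locales (auto simp: algebra_simps fun_eq_iff)

text \<open>A basis chosen inside \<open>S\<close> has two members, which serve as \<open>g\<close>
  and \<open>h\<close>.\<close>

lemma dim_two_factor:
  fixes S :: "('b \<Rightarrow> 'a::field) set"
  assumes "finite S" and "vector_space.dim (\<lambda>c (f :: 'b \<Rightarrow> 'a) u. c * f u) S = 2"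
  obtains g h where "\<And>f. f \<in> S \<Longrightarrow> \<exists>x y. \<forall>u. f u = x * g u + y * h u"
proof -
  interpret vector_space "\<lambda>c (f :: 'b \<Rightarrow> 'a) u. c * f u" by (rule vector_space_funs)
  obtain T where T: "T \<subseteq> S" "S \<subseteq> span T" "card T = 2"
    using basis_exists[of S] assms(2) by metis
  obtain g h where gh: "T = {g, h}"
    using T(3) by (meson card_2_iff)
  have "\<exists>x y. \<forall>u. f u = x * g u + y * h u" if "f \<in> S" for f
  proof -
    have "f \<in> span {g, h}" using that T(2) gh by auto
    then obtain x y where "f - (\<lambda>u. x * g u) = (\<lambda>u. y * h u)"
      by (auto simp: span_insert span_singleton)
    then have "f u = x * g u + y * h u" for u
      by (metis add.commute diff_add_cancel fun_diff_def)
    then show ?thesis by blast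
  qed
  then show thesis using that by blast
qed

lemma dim_eq_two:
  fixes S :: "('b \<Rightarrow> 'a::field) set"
  assumes "g \<in> S" "h \<in> S"
    and comb: "\<And>f. f \<in> S \<Longrightarrow> \<exists>x y. \<forall>u. f u = x * g u + y * h u"
    and indep: "\<And>x y. (\<And>u. x * g u + y * h u = 0) \<Longrightarrow> x = 0 \<and> y = 0"
  shows "vector_space.dim (\<lambda>c (f :: 'b \<Rightarrow> 'a) u. c * f u) S = 2"
proof -
  interpret vector_space "\<lambda>c (f :: 'b \<Rightarrow> 'a) u. c * f u" by (rule vector_space_funs)
  have h0: "h \<noteq> 0"
    using indep[of 0 1] by (auto simp: zero_fun_def)
  have gnot: "g \<notin> span {h}"
  proof
    assume "g \<in> span {h}"
    then obtain y where "g = (\<lambda>u. y * h u)" by (auto simp: span_singleton)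
    then show False using indep[of 1 "- y"] by (auto simp: fun_eq_iff)
  qed
  have gh: "g \<noteq> h" using gnot span_base by auto
  have "independent {g, h}"
    using gnot h0 gh by (simp add: independent_insert)
  moreover have "S \<subseteq> span {g, h}"
  proof
    fix f assume "f \<in> S"
    then obtain x y where "\<forall>u. f u = x * g u + y * h u" using comb by blast
    then have "f = (\<lambda>u. x * g u) + (\<lambda>u. y * h u)" by (auto simp: fun_eq_iff)
    then show "f \<in> span {g, h}"
      by (simp add: span_add span_scale span_base)
  qed
  ultimately show ?thesis
    using assms(1,2) gh by (intro dim_unique[of "{g, h}"]) auto
qed

section \<open>Collinearity of points in a plane over a field\<close>

definition aligned :: "'a::field \<times> 'a \<Rightarrow> 'a \<times> 'a \<Rightarrow> 'a \<times> 'a \<Rightarrow> bool" where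
  "aligned P Q R \<longleftrightarrow>
     (fst Q - fst P) * (snd R - snd P) - (fst R - fst P) * (snd Q - snd P) = 0"

text \<open>The defining expression is the cross product of \<open>Q - P\<close> and
  \<open>R - P\<close>. It is antisymmetric in the three points, so repeated points are always
  aligned and the order does not matter.\<close>

lemma aligned_refl: "aligned P P Q" and aligned_swap: "aligned P Q R = aligned Q P R"
  and aligned_right_swap: "aligned P Q R = aligned P R Q"
  unfolding aligned_def by (simp, algebra+)

lemma aligned_scale:
  assumes "aligned (t1, d1) (t2, d2) (t3, d3)"
  shows "aligned (s * t1, d1) (s * t2, d2) (s * t3, d3)"
proof -
  have "(s * t2 - s * t1) * (d3 - d1) - (s * t3 - s * t1) * (d2 - d1)
    = s * ((t2 - t1) * (d3 - d1) - (t3 - t1) * (d2 - d1))"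
    by algebra
  with assms show ?thesis unfolding aligned_def by simp
qed

text \<open>An affine function vanishing at two distinct points vanishes on the whole line through
  them.\<close>

lemma aligned_on_line:
  assumes "aligned P Q R" "P \<noteq> Q"
    and "l + m * fst P + r * snd P = 0" "l + m * fst Q + r * snd Q = 0"
  shows "l + m * fst R + r * snd R = 0"
proof (cases "fst P = fst Q")
  \<comment> \<open>The line is vertical: \<open>r\<close> must vanish, and \<open>R\<close> shares
    its first coordinate with \<open>P\<close>.\<close>
  case True
  then have d: "snd P \<noteq> snd Q" using assms(2) by (simp add: prod_eq_iff)
  have "fst R = fst P" using assms(1) True d by (simp add: aligned_def)
  moreover have "r * (snd P - snd Q) = 0" using assms(3,4) True by algebra
  ultimately show ?thesis using assms(3) d by simp
next
  case False
  have "(l + m * fst R + r * snd R) * (fst Q - fst P) = 0"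
    using assms(1,3,4) unfolding aligned_def by algebra
  then show ?thesis using False by simp
qed

lemma aligned_imp_line:
  fixes S :: "('a::field \<times> 'a) set"
  assumes "\<And>P Q R. P \<in> S \<Longrightarrow> Q \<in> S \<Longrightarrow> R \<in> S \<Longrightarrow> aligned P Q R"
  shows "\<exists>l m r. (l, m, r) \<noteq> (0, 0, 0) \<and> (\<forall>P\<in>S. l + m * fst P + r * snd P = 0)"
proof (cases "\<exists>P\<in>S. \<exists>Q\<in>S. P \<noteq> Q")
  case True
  then obtain P Q where PQ: "P \<in> S" "Q \<in> S" "P \<noteq> Q" by blast
  \<comment> \<open>\<open>(m, r)\<close> is normal to \<open>Q - P\<close>, and \<open>l\<close> is
    chosen so that the line passes through \<open>P\<close>.\<close>
  define m r where "m = snd P - snd Q" and "r = fst Q - fst P"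
  define l where "l = - m * fst P - r * snd P"
  have "(l, m, r) \<noteq> (0, 0, 0)" using PQ(3) by (auto simp: m_def r_def prod_eq_iff)
  moreover have "l + m * fst P + r * snd P = 0" by (simp add: l_def)
  moreover have "l + m * fst Q + r * snd Q = 0" by (simp add: l_def m_def r_def algebra_simps)
  ultimately show ?thesis
    using aligned_on_line[OF assms[OF PQ(1,2)] PQ(3)] by blast
next
  case False
  then obtain P where "S \<subseteq> {P}" by (cases "S = {}") auto
  \<comment> \<open>At most one point is present; the vertical line through it will do.\<close>
  then have "\<forall>Q\<in>S. - fst P + 1 * fst Q + 0 * snd Q = 0" by auto
  then show ?thesis by (intro exI[of _ "- fst P"] exI[of _ 1] exI[of _ 0]) simp
qed

text \<open>Peels points off a finite set one at a time. By the symmetry of \<open>aligned\<close>,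
  each unordered triple is left to be checked only once.\<close>

lemma aligned_insert:
  "(\<forall>P\<in>insert x S. \<forall>Q\<in>insert x S. \<forall>R\<in>insert x S. aligned P Q R) \<longleftrightarrow>
     (\<forall>P\<in>S. \<forall>Q\<in>S. \<forall>R\<in>S. aligned P Q R) \<and> (\<forall>P\<in>S. \<forall>Q\<in>S. aligned x P Q)"
  "(\<forall>P\<in>insert y S. \<forall>Q\<in>insert y S. aligned x P Q) \<longleftrightarrow>
     (\<forall>P\<in>S. \<forall>Q\<in>S. aligned x P Q) \<and> (\<forall>P\<in>S. aligned x y P)"
  by (safe; simp; metis aligned_refl aligned_swap aligned_right_swap)+

text \<open>Six points have twenty unordered triples. The hypotheses list them in the orders
  produced by cyclic rotation of the indices.\<close>

lemma aligned_six_points: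
  assumes "aligned B1 B2 B3" "aligned O1 O2 O3"
    and "aligned B1 B2 O1" "aligned B1 B2 O2" "aligned B1 B2 O3"
    and "aligned B2 B3 O1" "aligned B2 B3 O2" "aligned B2 B3 O3"
    and "aligned B3 B1 O1" "aligned B3 B1 O2" "aligned B3 B1 O3"
    and "aligned B1 O1 O2" "aligned B1 O2 O3" "aligned B1 O1 O3"
    and "aligned B2 O1 O2" "aligned B2 O2 O3" "aligned B2 O1 O3"
    and "aligned B3 O1 O2" "aligned B3 O2 O3" "aligned B3 O1 O3"
    and "P \<in> {B1, B2, B3, O1, O2, O3}" "Q \<in> {B1, B2, B3, O1, O2, O3}"
      "R \<in> {B1, B2, B3, O1, O2, O3}"
  shows "aligned P Q R"
proof -
  have "aligned B1 B3 O1" "aligned B1 B3 O2" "aligned B1 B3 O3"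
    using assms(9-11) by (metis aligned_swap)+
  then have "\<forall>P\<in>{B1, B2, B3, O1, O2, O3}. \<forall>Q\<in>{B1, B2, B3, O1, O2, O3}.
    \<forall>R\<in>{B1, B2, B3, O1, O2, O3}. aligned P Q R"
    unfolding aligned_insert(1) unfolding aligned_insert(2) using assms(1-20) by simp
  then show ?thesis using assms(21-) by blast
qed

section \<open>The quadratic action on a single cube and its Hessian\<close>

datatype vertex = X0 | X1 | X2 | X3 | Y0 | Y1 | Y2 | Y3

lemma UNIV_vertex: "UNIV = {X0, X1, X2, X3, Y0, Y1, Y2, Y3}"
  by (auto intro: vertex.exhaust)

text \<open>
  The index \<open>c = 1, 2, 3\<close> stands for the plaquettes \<open>jk\<close>, \<open>ki\<close>, \<open>ij\<close>. The coefficients \<open>\<alpha>\<close>, \<open>\<beta>\<close>, \<open>\<gamma>\<close> are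
  \<open>a\<^sub>c\<close>, \<open>b\<^sub>c\<close>, \<open>c\<^sub>c\<close> on a base plaquette and the corresponding capitals on the opposite one.
\<close>

locale cube =
  fixes a1 a2 a3 b1 b2 b3 c1 c2 c3 A1 A2 A3 B1 B2 B3 C1 C2 C3 :: "'a::real_normed_field"
begin

text \<open>The letters X and Y separate the two parity classes of vertices: every plaquette has one
  diagonal in each class. \<open>X0\<close> is the base point and \<open>Y0\<close> its antipode;
  \<open>X0\<close>-\<open>Xc\<close> is a diagonal of the base plaquette with index c, and
  \<open>Y0\<close>-\<open>Yc\<close> one of the opposite plaquette.\<close>

definition action :: "(vertex \<Rightarrow> 'a) \<Rightarrow> 'a" where
  "action U =
     1/2 * A3 * (U Y0 - U Y3)\<^sup>2 + B3 * (U Y0 - U Y3) * (U X2 - U X1) + 1/2 * C3 * (U X2 - U X1)\<^sup>2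
   - (1/2 * a3 * (U X3 - U X0)\<^sup>2 + b3 * (U X3 - U X0) * (U Y1 - U Y2) + 1/2 * c3 * (U Y1 - U Y2)\<^sup>2)
   + (1/2 * A1 * (U Y0 - U Y1)\<^sup>2 + B1 * (U Y0 - U Y1) * (U X3 - U X2) + 1/2 * C1 * (U X3 - U X2)\<^sup>2
   - (1/2 * a1 * (U X1 - U X0)\<^sup>2 + b1 * (U X1 - U X0) * (U Y2 - U Y3) + 1/2 * c1 * (U Y2 - U Y3)\<^sup>2))
   + (1/2 * A2 * (U Y0 - U Y2)\<^sup>2 + B2 * (U Y0 - U Y2) * (U X1 - U X3) + 1/2 * C2 * (U X1 - U X3)\<^sup>2
   - (1/2 * a2 * (U X2 - U X0)\<^sup>2 + b2 * (U X2 - U X0) * (U Y3 - U Y1) + 1/2 * c2 * (U Y3 - U Y1)\<^sup>2))"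

text \<open>The partial derivatives of \<open>action\<close>, grouped plaquette by plaquette so that
  \<open>corner_eq_0\<close> can rewrite each group as a whole.\<close>

primrec corner :: "vertex \<Rightarrow> (vertex \<Rightarrow> 'a) \<Rightarrow> 'a" where
  "corner X0 U = a1 * (U X1 - U X0) + b1 * (U Y2 - U Y3) + (a2 * (U X2 - U X0) + b2 * (U Y3 - U Y1))
     + (a3 * (U X3 - U X0) + b3 * (U Y1 - U Y2))"
| "corner X1 U = - (a1 * (U X1 - U X0) + b1 * (U Y2 - U Y3))
     + (B2 * (U Y0 - U Y2) + C2 * (U X1 - U X3)) - (B3 * (U Y0 - U Y3) + C3 * (U X2 - U X1))"
| "corner X2 U = - (a2 * (U X2 - U X0) + b2 * (U Y3 - U Y1))
     + (B3 * (U Y0 - U Y3) + C3 * (U X2 - U X1)) - (B1 * (U Y0 - U Y1) + C1 * (U X3 - U X2))"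
| "corner X3 U = - (a3 * (U X3 - U X0) + b3 * (U Y1 - U Y2))
     + (B1 * (U Y0 - U Y1) + C1 * (U X3 - U X2)) - (B2 * (U Y0 - U Y2) + C2 * (U X1 - U X3))"
| "corner Y0 U = A1 * (U Y0 - U Y1) + B1 * (U X3 - U X2) + (A2 * (U Y0 - U Y2) + B2 * (U X1 - U X3))
     + (A3 * (U Y0 - U Y3) + B3 * (U X2 - U X1))"
| "corner Y1 U = - (A1 * (U Y0 - U Y1) + B1 * (U X3 - U X2))
     + (b2 * (U X2 - U X0) + c2 * (U Y3 - U Y1)) - (b3 * (U X3 - U X0) + c3 * (U Y1 - U Y2))"
| "corner Y2 U = - (A2 * (U Y0 - U Y2) + B2 * (U X1 - U X3))
     + (b3 * (U X3 - U X0) + c3 * (U Y1 - U Y2)) - (b1 * (U X1 - U X0) + c1 * (U Y2 - U Y3))"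
| "corner Y3 U = - (A3 * (U Y0 - U Y3) + B3 * (U X2 - U X1))
     + (b1 * (U X1 - U X0) + c1 * (U Y2 - U Y3)) - (b2 * (U X2 - U X0) + c2 * (U Y3 - U Y1))"

definition hess :: "vertex \<Rightarrow> vertex \<Rightarrow> 'a" where
  "hess r s = corner r (\<lambda>v. of_bool (v = s))"

text \<open>The Taylor expansion in one vertex value stops after second order because the action is
  quadratic.\<close>

lemma action_fun_upd:
  "action (U(v := t)) = action U + corner v U * (t - U v) + 1/2 * hess v v * (t - U v)\<^sup>2"
  unfolding action_def hess_def
  by (cases v; simp add: power2_eq_square; simp add: field_simps)

lemma deriv_action: "deriv (\<lambda>t. action (U(v := t))) (U v) = corner v U"
  unfolding action_fun_upd
  by (rule DERIV_imp_deriv) (auto intro!: derivative_eq_intros)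

definition minor :: "vertex \<Rightarrow> vertex \<Rightarrow> vertex \<Rightarrow> vertex \<Rightarrow> vertex \<Rightarrow> vertex \<Rightarrow> 'a" where
  "minor r1 r2 r3 s1 s2 s3 =
     hess r1 s1 * (hess r2 s2 * hess r3 s3 - hess r2 s3 * hess r3 s2)
   - hess r1 s2 * (hess r2 s1 * hess r3 s3 - hess r2 s3 * hess r3 s1)
   + hess r1 s3 * (hess r2 s1 * hess r3 s2 - hess r2 s2 * hess r3 s1)"

definition rank_le_two :: bool where
  "rank_le_two \<longleftrightarrow> (\<exists>g h. \<forall>v. \<exists>x y. \<forall>U. corner v U = x * g U + y * h U)"

text \<open>The Hessian is the product of an eight by two matrix, with rows
  \<open>(x v, y v)\<close>, and a two by eight matrix holding the values of \<open>g\<close> and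
  \<open>h\<close> on indicator fields.\<close>

lemma minor_eq_0:
  assumes rank_le_two
  shows "minor r1 r2 r3 s1 s2 s3 = 0"
proof -
  obtain g h where "\<forall>v. \<exists>x y. \<forall>U. corner v U = x * g U + y * h U"
    using assms unfolding rank_le_two_def by blast
  then obtain x y where "\<And>v U. corner v U = x v * g U + y v * h U"
    by metis
  then show ?thesis
    unfolding minor_def hess_def by (simp add: algebra_simps)
qed

text \<open>These eight triples represent all twenty up to cyclic rotation of the
  directions.\<close>

lemma aligned_if_rank_le_two:
  assumes rank_le_two
  shows
    "aligned (- b1, b1\<^sup>2 - a1 * c1) (- b2, b2\<^sup>2 - a2 * c2) (- b3, b3\<^sup>2 - a3 * c3)"
    "aligned (B1, B1\<^sup>2 - A1 * C1) (B2, B2\<^sup>2 - A2 * C2) (B3, B3\<^sup>2 - A3 * C3)"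
    "aligned (- b1, b1\<^sup>2 - a1 * c1) (- b2, b2\<^sup>2 - a2 * c2) (B1, B1\<^sup>2 - A1 * C1)"
    "aligned (- b1, b1\<^sup>2 - a1 * c1) (- b2, b2\<^sup>2 - a2 * c2) (B2, B2\<^sup>2 - A2 * C2)"
    "aligned (- b1, b1\<^sup>2 - a1 * c1) (- b2, b2\<^sup>2 - a2 * c2) (B3, B3\<^sup>2 - A3 * C3)"
    "aligned (- b1, b1\<^sup>2 - a1 * c1) (B1, B1\<^sup>2 - A1 * C1) (B2, B2\<^sup>2 - A2 * C2)"
    "aligned (- b1, b1\<^sup>2 - a1 * c1) (B2, B2\<^sup>2 - A2 * C2) (B3, B3\<^sup>2 - A3 * C3)"
    "aligned (- b1, b1\<^sup>2 - a1 * c1) (B1, B1\<^sup>2 - A1 * C1) (B3, B3\<^sup>2 - A3 * C3)"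
proof -
  note minor = minor_eq_0[OF assms]
  note expand = minor_def hess_def aligned_def
  show "aligned (- b1, b1\<^sup>2 - a1 * c1) (- b2, b2\<^sup>2 - a2 * c2) (- b3, b3\<^sup>2 - a3 * c3)"
    using minor[of X3 X0 Y2 X0 Y1 Y3] minor[of X2 X0 Y3 X0 Y1 Y2]
    by (simp add: expand) algebra
  show "aligned (B1, B1\<^sup>2 - A1 * C1) (B2, B2\<^sup>2 - A2 * C2) (B3, B3\<^sup>2 - A3 * C3)"
    using minor[of X1 X3 Y0 X2 Y3 Y0] minor[of X1 X2 Y0 X3 Y2 Y0]
    by (simp add: expand) algebra
  show "aligned (- b1, b1\<^sup>2 - a1 * c1) (- b2, b2\<^sup>2 - a2 * c2) (B1, B1\<^sup>2 - A1 * C1)"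
    using minor[of X1 X2 Y3 X0 Y1 Y2] minor[of X2 Y3 Y0 X3 X0 Y1]
    by (simp add: expand) algebra
  show "aligned (- b1, b1\<^sup>2 - a1 * c1) (- b2, b2\<^sup>2 - a2 * c2) (B2, B2\<^sup>2 - A2 * C2)"
    using minor[of X1 X2 Y3 X0 Y1 Y2] minor[of X1 Y3 Y0 X3 X0 Y2]
    by (simp add: expand) algebra
  show "aligned (- b1, b1\<^sup>2 - a1 * c1) (- b2, b2\<^sup>2 - a2 * c2) (B3, B3\<^sup>2 - A3 * C3)"
    using minor[of X1 X0 Y3 X2 Y1 Y3] minor[of X1 Y2 Y3 X2 X0 Y3]
    by (simp add: expand) algebra
  show "aligned (- b1, b1\<^sup>2 - a1 * c1) (B1, B1\<^sup>2 - A1 * C1) (B2, B2\<^sup>2 - A2 * C2)"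
    using minor[of X1 Y3 Y0 X3 X0 Y2] minor[of X1 X2 Y0 X3 Y1 Y2]
    by (simp add: expand) algebra
  show "aligned (- b1, b1\<^sup>2 - a1 * c1) (B2, B2\<^sup>2 - A2 * C2) (B3, B3\<^sup>2 - A3 * C3)"
    using minor[of X1 X2 Y3 X1 Y2 Y0] minor[of X1 X3 Y2 X1 Y3 Y0]
    by (simp add: expand) algebra
  show "aligned (- b1, b1\<^sup>2 - a1 * c1) (B1, B1\<^sup>2 - A1 * C1) (B3, B3\<^sup>2 - A3 * C3)"
    using minor[of X1 Y2 Y0 X2 X0 Y3] minor[of X1 X3 Y0 X2 Y1 Y3]
    by (simp add: expand) algebra
qed

text \<open>With \<open>qc = (y - bc) / ac\<close> and \<open>P3 = (x + B3) / A3\<close>, division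
  by \<open>a1 * a2 * a3 * A3\<close> turns this into
  \<open>P3 * (q1 * q2 + q2 * q3 + q3 * q1) = q3\<close>.\<close>

lemma star_polynomial:
  assumes rank_le_two
    and "a2 * c2 = (x - b2) * (y - b2)"
    and "a3 * c3 = (x - b3) * (y - b3)" and "A3 * C3 = (x + B3) * (y + B3)"
  shows "(b3 - y) * A3 * a1 * a2 + (x + B3) *
    ((b1 - y) * (b2 - y) * a3 + (b2 - y) * (b3 - y) * a1 + (b3 - y) * (b1 - y) * a2) = 0"
    (is "?T = 0")
proof -
  \<comment> \<open>An explicit certificate: every summand has a minor or one of the three quadratic
    constraints as a factor.\<close>
  have "?T = (b3 - y) * minor X1 X0 Y0 X2 X0 Y3
      - (b3 - y) * minor X1 X2 X3 X0 Y1 Y3 - a3 * minor X2 X0 Y1 X0 Y2 Y3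
      + (a2 * c2 - (x - b2) * (y - b2)) * (a3 * (b1 - y) - a3 * (b3 - y))
      + (a3 * c3 - (x - b3) * (y - b3)) * (a2 * (b1 - y) + a3 * (b2 - y) + a1 * (b2 - y)
          + (B3 + y) * (a1 + a2 + a3))
      + (A3 * C3 - (x + B3) * (y + B3)) * (b3 - y) * (a1 + a2 + a3)"
    by (simp add: minor_def hess_def) algebra
  then show ?thesis
    using assms by (simp add: minor_eq_0)
qed

text \<open>On a solution of the Moutard equations each plaquette contributes to a corner equation
  \<open>x\<close> or \<open>y\<close> times a difference of two field values, up to sign. The three
  differences at a corner telescope. Exchanging \<open>x\<close> and \<open>y\<close> covers the
  second family, with coefficients (q, P).\<close>

lemma corner_eq_0:
  assumes base: "U X1 - U X0 = p1 * (U Y2 - U Y3)" "U X2 - U X0 = p2 * (U Y3 - U Y1)"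
      "U X3 - U X0 = p3 * (U Y1 - U Y2)"
    and opp: "U Y1 - U Y0 = Q1 * (U X3 - U X2)" "U Y2 - U Y0 = Q2 * (U X1 - U X3)"
      "U Y3 - U Y0 = Q3 * (U X2 - U X1)"
    and b: "a1 * p1 + b1 = x" "a2 * p2 + b2 = x" "a3 * p3 + b3 = x"
    and c: "b1 * p1 + c1 = y * p1" "b2 * p2 + c2 = y * p2" "b3 * p3 + c3 = y * p3"
    and B: "A1 * Q1 - B1 = y" "A2 * Q2 - B2 = y" "A3 * Q3 - B3 = y"
    and C: "C1 - B1 * Q1 = x * Q1" "C2 - B2 * Q2 = x * Q2" "C3 - B3 * Q3 = x * Q3"
  shows "corner v U = 0"
proof -
  have base_X: "a1 * (U X1 - U X0) + b1 * (U Y2 - U Y3) = x * (U Y2 - U Y3)"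
    "a2 * (U X2 - U X0) + b2 * (U Y3 - U Y1) = x * (U Y3 - U Y1)"
    "a3 * (U X3 - U X0) + b3 * (U Y1 - U Y2) = x * (U Y1 - U Y2)"
    using base b by algebra+
  have base_Z: "b1 * (U X1 - U X0) + c1 * (U Y2 - U Y3) = y * (U X1 - U X0)"
    "b2 * (U X2 - U X0) + c2 * (U Y3 - U Y1) = y * (U X2 - U X0)"
    "b3 * (U X3 - U X0) + c3 * (U Y1 - U Y2) = y * (U X3 - U X0)"
    using base c by algebra+
  have opp_Y: "A1 * (U Y0 - U Y1) + B1 * (U X3 - U X2) = - y * (U X3 - U X2)"
    "A2 * (U Y0 - U Y2) + B2 * (U X1 - U X3) = - y * (U X1 - U X3)"
    "A3 * (U Y0 - U Y3) + B3 * (U X2 - U X1) = - y * (U X2 - U X1)"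
    using opp B by algebra+
  have opp_W: "B1 * (U Y0 - U Y1) + C1 * (U X3 - U X2) = x * (U Y1 - U Y0)"
    "B2 * (U Y0 - U Y2) + C2 * (U X1 - U X3) = x * (U Y2 - U Y0)"
    "B3 * (U Y0 - U Y3) + C3 * (U X2 - U X1) = x * (U Y3 - U Y0)"
    using opp C by algebra+
  show ?thesis
    by (cases v; simp only: corner.simps base_X base_Z opp_Y opp_W; simp add: algebra_simps)
qed

lemma corner_expand:
  "corner v U = hess v X0 * U X0 + hess v X1 * U X1 + hess v X2 * U X2 + hess v X3 * U X3
     + hess v Y0 * U Y0 + hess v Y1 * U Y1 + hess v Y2 * U Y2 + hess v Y3 * U Y3"
  by (cases v) (simp_all add: hess_def algebra_simps)

text \<open>The action involves only differences within a parity class, so a field constant on each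
  class lies in the kernel.\<close>

lemma hess_row_sums:
  "hess v X0 + hess v X1 + hess v X2 + hess v X3 = 0"
  "hess v Y0 + hess v Y1 + hess v Y2 + hess v Y3 = 0"
  by (cases v; simp add: hess_def)+

text \<open>Solutions normalized by zero at \<open>X0\<close> and \<open>Y0\<close>. Put
  \<open>m3 = - m1 - m2\<close>: the values \<open>Yc\<close> are \<open>pc * mc\<close>, and the
  values \<open>Xc\<close> are then forced by the Moutard equations on the base plaquettes.\<close>

definition ker_field :: "'a \<Rightarrow> 'a \<Rightarrow> 'a \<Rightarrow> 'a \<Rightarrow> 'a \<Rightarrow> vertex \<Rightarrow> 'a" where
  "ker_field p1 p2 p3 m1 m2 = (\<lambda>v. case v of X0 \<Rightarrow> 0 | Y0 \<Rightarrow> 0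
     | Y1 \<Rightarrow> p1 * m1 | Y2 \<Rightarrow> p2 * m2 | Y3 \<Rightarrow> p3 * (- m1 - m2)
     | X1 \<Rightarrow> p1 * (p2 * m2 - p3 * (- m1 - m2))
     | X2 \<Rightarrow> p2 * (p3 * (- m1 - m2) - p1 * m1)
     | X3 \<Rightarrow> p3 * (p1 * m1 - p2 * m2))"

text \<open>For these fields \<open>X3 - X2 = e * m1\<close>, and cyclically, since the
  \<open>mc\<close> sum to zero. The Moutard equations on the opposite plaquettes thus reduce to the
  star-triangle relations \<open>Qc * e = pc\<close>.\<close>

lemma corner_ker_field_eq_0:
  fixes p1 p2 p3 Q1 Q2 Q3
  defines "e \<equiv> p1 * p2 + p2 * p3 + p3 * p1"
  assumes star: "Q1 * e = p1" "Q2 * e = p2" "Q3 * e = p3"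
    and b: "a1 * p1 + b1 = x" "a2 * p2 + b2 = x" "a3 * p3 + b3 = x"
    and c: "b1 * p1 + c1 = y * p1" "b2 * p2 + c2 = y * p2" "b3 * p3 + c3 = y * p3"
    and B: "A1 * Q1 - B1 = y" "A2 * Q2 - B2 = y" "A3 * Q3 - B3 = y"
    and C: "C1 - B1 * Q1 = x * Q1" "C2 - B2 * Q2 = x * Q2" "C3 - B3 * Q3 = x * Q3"
  shows "corner v (ker_field p1 p2 p3 m1 m2) = 0"
proof (rule corner_eq_0[OF _ _ _ _ _ _ b c B C])
  let ?U = "ker_field p1 p2 p3 m1 m2"
  have "?U Y1 - ?U Y0 = p1 * m1" "?U X3 - ?U X2 = e * m1"
    by (simp_all add: ker_field_def e_def algebra_simps)
  then show "?U Y1 - ?U Y0 = Q1 * (?U X3 - ?U X2)"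
    using star(1) by simp
  have "?U Y2 - ?U Y0 = p2 * m2" "?U X1 - ?U X3 = e * m2"
    by (simp_all add: ker_field_def e_def algebra_simps)
  then show "?U Y2 - ?U Y0 = Q2 * (?U X1 - ?U X3)"
    using star(2) by simp
  have "?U Y3 - ?U Y0 = p3 * (- m1 - m2)" "?U X2 - ?U X1 = e * (- m1 - m2)"
    by (simp_all add: ker_field_def e_def algebra_simps)
  then show "?U Y3 - ?U Y0 = Q3 * (?U X2 - ?U X1)"
    using star(3) by simp
qed (simp_all add: ker_field_def)


text \<open>Subtracting multiples of two corner equations kills two of the eight coefficients. Six
  kernel fields annihilate the rest: two from each Moutard family and the constants on the two
  parity classes.\<close>

lemma corner_combination:
  assumes "x \<noteq> y"
    and nz: "a1 \<noteq> 0" "a2 \<noteq> 0" "a3 \<noteq> 0" "A1 \<noteq> 0" "A2 \<noteq> 0" "A3 \<noteq> 0"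
    and p: "a1 * p1 + b1 = x" "a2 * p2 + b2 = x" "a3 * p3 + b3 = x"
    and q: "a1 * q1 + b1 = y" "a2 * q2 + b2 = y" "a3 * q3 + b3 = y"
    and c: "c1 = a1 * p1 * q1" "c2 = a2 * p2 * q2" "c3 = a3 * p3 * q3"
    and P: "A1 * P1 - B1 = x" "A2 * P2 - B2 = x" "A3 * P3 - B3 = x"
    and Q: "A1 * Q1 - B1 = y" "A2 * Q2 - B2 = y" "A3 * Q3 - B3 = y"
    and C: "C1 = A1 * P1 * Q1" "C2 = A2 * P2 * Q2" "C3 = A3 * P3 * Q3"
    and star_p: "Q1 * (p1 * p2 + p2 * p3 + p3 * p1) = p1" "Q2 * (p1 * p2 + p2 * p3 + p3 * p1) = p2"
      "Q3 * (p1 * p2 + p2 * p3 + p3 * p1) = p3"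
    and star_q: "P1 * (q1 * q2 + q2 * q3 + q3 * q1) = q1" "P2 * (q1 * q2 + q2 * q3 + q3 * q1) = q2"
      "P3 * (q1 * q2 + q2 * q3 + q3 * q1) = q3"
    and pnz: "p1 \<noteq> 0" "p2 \<noteq> 0" "p3 \<noteq> 0" and qnz: "q1 \<noteq> 0" "q2 \<noteq> 0" "q3 \<noteq> 0"
  shows "\<exists>s t. \<forall>U. corner v U = s * corner X3 U + t * corner Y1 U"
proof -
  have PQnz: "P1 \<noteq> 0" "P2 \<noteq> 0" "P3 \<noteq> 0" "Q1 \<noteq> 0" "Q2 \<noteq> 0" "Q3 \<noteq> 0"
    using star_p star_q pnz qnz by auto
  have base: "b * r + a * s * r = z * r" "b * r + a * r * s = z * r" if "a * s + b = z" for a b r s z :: 'a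
    unfolding that[symmetric] by (simp_all add: algebra_simps)
  have opp: "a * s * r - b * r = z * r" "a * r * s - b * r = z * r" if "a * s - b = z" for a b r s z :: 'a
    unfolding that[symmetric] by (simp_all add: algebra_simps)
  have cx: "b1 * q1 + c1 = x * q1" "b2 * q2 + c2 = x * q2" "b3 * q3 + c3 = x * q3"
    using base[OF p(1)] base[OF p(2)] base[OF p(3)] by (simp_all add: c)
  have cy: "b1 * p1 + c1 = y * p1" "b2 * p2 + c2 = y * p2" "b3 * p3 + c3 = y * p3"
    using base[OF q(1)] base[OF q(2)] base[OF q(3)] by (simp_all add: c)
  have Cx: "C1 - B1 * Q1 = x * Q1" "C2 - B2 * Q2 = x * Q2" "C3 - B3 * Q3 = x * Q3"
    using opp[OF P(1)] opp[OF P(2)] opp[OF P(3)] by (simp_all add: C)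
  have Cy: "C1 - B1 * P1 = y * P1" "C2 - B2 * P2 = y * P2" "C3 - B3 * P3 = y * P3"
    using opp[OF Q(1)] opp[OF Q(2)] opp[OF Q(3)] by (simp_all add: C)
  note ker_p = corner_ker_field_eq_0[OF star_p p cy Q Cx]
  note ker_q = corner_ker_field_eq_0[OF star_q q cx P Cy]
  have "C1 \<noteq> 0" "c2 \<noteq> 0"
    using PQnz pnz qnz nz c(2) C(1) by simp_all
  then have hess_nz: "hess X3 X2 \<noteq> 0" "hess Y1 Y3 \<noteq> 0" and hess_0: "hess X3 Y3 = 0"
    by (simp_all add: hess_def)
  \<comment> \<open>The columns \<open>Y3\<close> and \<open>X2\<close> are pivots with entries
    \<open>c2\<close> and \<open>- C1\<close>; as \<open>hess X3 Y3 = 0\<close>, the system for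
    \<open>t\<close> and \<open>s\<close> is triangular.\<close>
  define t where "t = hess v Y3 / hess Y1 Y3"
  define s where "s = (hess v X2 - t * hess Y1 X2) / hess X3 X2"
  define k where "k w = hess v w - s * hess X3 w - t * hess Y1 w" for w
  have k_expand: "corner v U - s * corner X3 U - t * corner Y1 U =
      k X0 * U X0 + k X1 * U X1 + k X2 * U X2 + k X3 * U X3
      + k Y0 * U Y0 + k Y1 * U Y1 + k Y2 * U Y2 + k Y3 * U Y3" for U
    unfolding corner_expand[of v U] corner_expand[of X3 U] corner_expand[of Y1 U] k_def
    by (simp add: algebra_simps)
  have k0: "k X2 = 0" "k Y3 = 0"
    using hess_nz hess_0 by (simp_all add: k_def s_def t_def)
  \<comment> \<open>The fields with \<open>m1 = 1\<close>, \<open>m2 = 0\<close> from both families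
    give two equations for \<open>k X1 + k X3\<close> and \<open>k Y1\<close>, independent because
    \<open>p3\<close> and \<open>q3\<close> differ.\<close>
  have p1: "(k X1 + k X3) * p3 + k Y1 = 0"
    using k_expand[of "ker_field p1 p2 p3 1 0"] k0 pnz
    by (simp add: ker_p) (simp add: ker_field_def; algebra)
  have q1: "(k X1 + k X3) * q3 + k Y1 = 0"
    using k_expand[of "ker_field q1 q2 q3 1 0"] k0 qnz
    by (simp add: ker_q) (simp add: ker_field_def; algebra)
  have "p3 \<noteq> q3" "P2 \<noteq> Q2" using p q P Q \<open>x \<noteq> y\<close> by auto
  have kX3: "k X3 = - k X1"
    using p1 q1 \<open>p3 \<noteq> q3\<close> by algebra
  then have kY1: "k Y1 = 0" using p1 by simp
  \<comment> \<open>The fields with \<open>m1 = 0\<close>, \<open>m2 = 1\<close> do the same for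
    \<open>k X1\<close> and \<open>k Y2\<close>, where the star-triangle relations turn the ratio of
    coefficients into \<open>Q2\<close> or \<open>P2\<close>.\<close>
  have "k X1 * (p1 * p2 + p2 * p3 + p3 * p1) + k Y2 * p2 = 0"
    using k_expand[of "ker_field p1 p2 p3 0 1"] k0 kX3 kY1
    by (simp add: ker_p) (simp add: ker_field_def; algebra)
  then have p2: "k X1 + k Y2 * Q2 = 0" using star_p pnz by algebra
  have "k X1 * (q1 * q2 + q2 * q3 + q3 * q1) + k Y2 * q2 = 0"
    using k_expand[of "ker_field q1 q2 q3 0 1"] k0 kX3 kY1
    by (simp add: ker_q) (simp add: ker_field_def; algebra)
  then have q2: "k X1 + k Y2 * P2 = 0" using star_q qnz by algebra
  have kY2: "k Y2 = 0" using p2 q2 \<open>P2 \<noteq> Q2\<close> by algebra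
  then have kX1: "k X1 = 0" using p2 by simp
  \<comment> \<open>Constants on the X class settle \<open>k X0\<close>; those on the Y class settle
    \<open>k Y0\<close> below.\<close>
  have "k X0 + k X1 + k X2 + k X3 = (hess v X0 + hess v X1 + hess v X2 + hess v X3)
      - s * (hess X3 X0 + hess X3 X1 + hess X3 X2 + hess X3 X3)
      - t * (hess Y1 X0 + hess Y1 X1 + hess Y1 X2 + hess Y1 X3)"
    by (simp add: k_def algebra_simps)
  then have kX0: "k X0 = 0" using kX1 k0 kX3 by (simp add: hess_row_sums)
  have "k Y0 + k Y1 + k Y2 + k Y3 = (hess v Y0 + hess v Y1 + hess v Y2 + hess v Y3)
      - s * (hess X3 Y0 + hess X3 Y1 + hess X3 Y2 + hess X3 Y3)
      - t * (hess Y1 Y0 + hess Y1 Y1 + hess Y1 Y2 + hess Y1 Y3)"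
    by (simp add: k_def algebra_simps)
  then have kY0: "k Y0 = 0" using kY1 k0 kY2 by (simp add: hess_row_sums)
  have "corner v U = s * corner X3 U + t * corner Y1 U" for U
    using k_expand[of U] k0 kX0 kX1 kX3 kY0 kY1 kY2 by (simp add: algebra_simps)
  then show ?thesis by blast
qed

text \<open>The same triangular pivots, read off at the indicator fields of \<open>Y3\<close> and
  \<open>X2\<close>.\<close>

lemma corner_independent:
  assumes "C1 \<noteq> 0" "c2 \<noteq> 0" and "\<And>U. s * corner X3 U + t * corner Y1 U = 0"
  shows "s = 0 \<and> t = 0"
proof -
  have "t * hess Y1 Y3 = 0" "s * hess X3 X2 + t * hess Y1 X2 = 0"
    using assms(3)[of "\<lambda>v. of_bool (v = Y3)"] assms(3)[of "\<lambda>v. of_bool (v = X2)"]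
    by (simp_all add: hess_def)
  with assms(1,2) show ?thesis by (simp add: hess_def)
qed

end

section \<open>Cubes of the lattice as instances of the abstract cube\<close>

lemma parity_sign_shift [simp]: "parity_sign (n + unit_shift k) = (- parity_sign n :: 'a::field)"
proof -
  have "(\<Sum>i\<in>UNIV. (n + unit_shift k) $ i) = (\<Sum>i\<in>UNIV. n $ i) + 1"
    by (simp add: unit_shift_def axis_def sum.distrib)
  then show ?thesis
    by (simp add: parity_sign_def power_int_add)
qed

lemma parity_sign_mult_self [simp]: "parity_sign n * parity_sign n = (1 :: 'a::field)"
  by (simp add: parity_sign_def power_int_minus_one_mult_self)

text \<open>Cyclic symmetry of the cube carries facts proved for one ordering of the directions to
  the other two.\<close>

lemma cube_action_rotate: "cube_action L n j k i u = cube_action L n i j k u"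
  by (simp add: cube_action_def)

lemma cube_vertices_rotate: "cube_vertices n j k i = cube_vertices n i j k"
  by (auto simp: cube_vertices_def add_ac)

lemma corner_rank_rotate: "corner_rank L n j k i = corner_rank L n i j k"
  by (simp add: corner_rank_def corner_lhs_def[abs_def] cube_action_rotate[of L n j k i]
      cube_vertices_rotate[of n j k i])

locale lattice_cube =
  fixes \<alpha> \<beta> \<gamma> :: "int ^ 'n::finite \<Rightarrow> 'n \<Rightarrow> 'n \<Rightarrow> 'a::real_normed_field"
    and n :: "int ^ 'n" and i j k :: 'n
  assumes dist: "distinct [i, j, k]"
begin

sublocale cube "\<alpha> n j k" "\<alpha> n k i" "\<alpha> n i j" "\<beta> n j k" "\<beta> n k i" "\<beta> n i j"
  "\<gamma> n j k" "\<gamma> n k i" "\<gamma> n i j"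
  "\<alpha> (n + unit_shift i) j k" "\<alpha> (n + unit_shift j) k i" "\<alpha> (n + unit_shift k) i j"
  "\<beta> (n + unit_shift i) j k" "\<beta> (n + unit_shift j) k i" "\<beta> (n + unit_shift k) i j"
  "\<gamma> (n + unit_shift i) j k" "\<gamma> (n + unit_shift j) k i" "\<gamma> (n + unit_shift k) i j" .

abbreviation (input) L where "L \<equiv> lagrangian \<alpha> \<beta> \<gamma>"

primrec pos :: "vertex \<Rightarrow> int ^ 'n" where
  "pos X0 = n"
| "pos X1 = n + unit_shift j + unit_shift k"
| "pos X2 = n + unit_shift i + unit_shift k"
| "pos X3 = n + unit_shift i + unit_shift j"
| "pos Y0 = n + unit_shift i + unit_shift j + unit_shift k"
| "pos Y1 = n + unit_shift i"
| "pos Y2 = n + unit_shift j"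
| "pos Y3 = n + unit_shift k"

text \<open>Distinct directions keep the eight fields independent, so changing one lattice value
  changes exactly one vertex value.\<close>

lemma inj_pos: "inj pos"
proof (rule injI)
  fix v w assume "pos v = pos w"
  then have "pos v $ i = pos w $ i" "pos v $ j = pos w $ j" "pos v $ k = pos w $ k" by simp_all
  then show "v = w"
    using dist by (cases v; cases w; simp add: unit_shift_def axis_def)
qed

lemma cube_vertices_eq: "cube_vertices n i j k = range pos"
  by (simp add: UNIV_vertex cube_vertices_def insert_commute)

lemma cube_action_eq: "cube_action L n i j k u = action (u \<circ> pos)"
  unfolding cube_action_def lagrangian_def action_def Let_def by (simp add: add_ac)

lemma corner_lhs_eq: "corner_lhs L n i j k (pos v) u = corner v (u \<circ> pos)"
proof -
  have "u(pos v := t) \<circ> pos = (u \<circ> pos)(v := t)" for t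
    using inj_pos by (auto simp: fun_eq_iff inj_eq)
  then show ?thesis
    using deriv_action[of "u \<circ> pos" v] by (simp add: corner_lhs_def cube_action_eq)
qed

lemma rank_le_two_if_corner_rank:
  assumes "corner_rank L n i j k = 2"
  shows rank_le_two
proof -
  have "finite (corner_lhs L n i j k ` cube_vertices n i j k)"
    by (simp add: cube_vertices_eq UNIV_vertex)
  then obtain g h where "\<And>f. f \<in> corner_lhs L n i j k ` cube_vertices n i j k \<Longrightarrow>
      \<exists>x y. \<forall>u. f u = x * g u + y * h u"
    using dim_two_factor assms unfolding corner_rank_def by metis
  then have "\<forall>v. \<exists>x y. \<forall>u. corner v (u \<circ> pos) = x * g u + y * h u"
    unfolding cube_vertices_eq corner_lhs_eq[symmetric] by blast
  \<comment> \<open>Every assignment of vertex values is the restriction of a lattice field, namely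
    of \<open>U \<circ> inv pos\<close>.\<close>
  moreover have "U \<circ> inv pos \<circ> pos = U" for U :: "vertex \<Rightarrow> 'a"
    using inj_pos by (simp add: comp_assoc)
  ultimately have "\<forall>v. \<exists>x y. \<forall>U. corner v U = x * g (U \<circ> inv pos) + y * h (U \<circ> inv pos)"
    by metis
  then show ?thesis
    unfolding rank_le_two_def
    by (intro exI[of _ "\<lambda>U. g (U \<circ> inv pos)"] exI[of _ "\<lambda>U. h (U \<circ> inv pos)"])
qed

lemma corner_rank_eq_two:
  assumes comb: "\<And>v. \<exists>s t. \<forall>U. corner v U = s * corner X3 U + t * corner Y1 U"
    and indep: "\<And>s t. (\<And>U. s * corner X3 U + t * corner Y1 U = 0) \<Longrightarrow> s = 0 \<and> t = 0"
  shows "corner_rank L n i j k = 2"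
  unfolding corner_rank_def cube_vertices_eq
proof (rule dim_eq_two[of "corner_lhs L n i j k (pos X3)" _ "corner_lhs L n i j k (pos Y1)"])
  show "\<exists>x y. \<forall>u. f u = x * corner_lhs L n i j k (pos X3) u + y * corner_lhs L n i j k (pos Y1) u"
    if "f \<in> corner_lhs L n i j k ` range pos" for f
  proof -
    from that obtain v where "f = corner_lhs L n i j k (pos v)" by blast
    then have "f u = corner v (u \<circ> pos)" for u by (simp only: corner_lhs_eq)
    moreover obtain s t where "\<forall>U. corner v U = s * corner X3 U + t * corner Y1 U"
      using comb by blast
    ultimately have "\<forall>u. f u = s * corner X3 (u \<circ> pos) + t * corner Y1 (u \<circ> pos)" by metis
    then show ?thesis unfolding corner_lhs_eq by blast
  qed
  fix x y
  assume *: "\<And>u. x * corner_lhs L n i j k (pos X3) u + y * corner_lhs L n i j k (pos Y1) u = 0"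
  have "U \<circ> inv pos \<circ> pos = U" for U :: "vertex \<Rightarrow> 'a"
    using inj_pos by (simp add: comp_assoc)
  then have "x * corner X3 U + y * corner Y1 U = 0" for U
    using *[of "U \<circ> inv pos"] by (simp only: corner_lhs_eq)
  then show "x = 0 \<and> y = 0" by (rule indep)
qed (rule imageI rangeI)+

end

section \<open>Collinearity of the coefficients around a cube\<close>

definition coeff_point ::
  "(int ^ 'n \<Rightarrow> 'n \<Rightarrow> 'n \<Rightarrow> 'a) \<Rightarrow> (int ^ 'n \<Rightarrow> 'n \<Rightarrow> 'n \<Rightarrow> 'a) \<Rightarrow> (int ^ 'n \<Rightarrow> 'n \<Rightarrow> 'n \<Rightarrow> 'a) \<Rightarrow>
    (int ^ 'n::finite) \<times> 'n \<times> 'n \<Rightarrow> 'a::field \<times> 'a" where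
  "coeff_point \<alpha> \<beta> \<gamma> = (\<lambda>(n, i, j).
     (- parity_sign n * \<beta> n i j, (\<beta> n i j)\<^sup>2 - \<alpha> n i j * \<gamma> n i j))"

text \<open>The constraint is incidence with a fixed line. The parity sign, which flips between base
  and opposite plaquettes, sits in the first coordinate of the point.\<close>

lemma coeff_constraint_iff_point:
  "coeff_constraint \<alpha> \<beta> \<gamma> l m r P \<longleftrightarrow>
     l + m * fst (coeff_point \<alpha> \<beta> \<gamma> P) + r * snd (coeff_point \<alpha> \<beta> \<gamma> P) = 0"
  by (cases P) (simp add: coeff_constraint_def coeff_point_def mult.assoc)

context lattice_cube
begin

text \<open>Scaling first coordinates by the parity of the base point covers even and odd cubes at
  once.\<close>

lemma aligned_coeff_points_cyclic:
  assumes "corner_rank (lagrangian \<alpha> \<beta> \<gamma>) n i j k = 2"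
  defines "B1 \<equiv> coeff_point \<alpha> \<beta> \<gamma> (n, j, k)" and "B2 \<equiv> coeff_point \<alpha> \<beta> \<gamma> (n, k, i)"
    and "B3 \<equiv> coeff_point \<alpha> \<beta> \<gamma> (n, i, j)"
    and "O1 \<equiv> coeff_point \<alpha> \<beta> \<gamma> (n + unit_shift i, j, k)"
    and "O2 \<equiv> coeff_point \<alpha> \<beta> \<gamma> (n + unit_shift j, k, i)"
    and "O3 \<equiv> coeff_point \<alpha> \<beta> \<gamma> (n + unit_shift k, i, j)"
  shows "aligned B1 B2 B3" "aligned O1 O2 O3" "aligned B1 B2 O1" "aligned B1 B2 O2"
    "aligned B1 B2 O3" "aligned B1 O1 O2" "aligned B1 O2 O3" "aligned B1 O1 O3"
  using aligned_if_rank_le_two[OF rank_le_two_if_corner_rank[OF assms(1)],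
      THEN aligned_scale, of "parity_sign n"]
  by (simp_all add: assms(2-) coeff_point_def)

end

lemma aligned_coeff_points:
  assumes dist: "distinct [i, j, k]" and rank: "corner_rank (lagrangian \<alpha> \<beta> \<gamma>) n i j k = 2"
    and "P \<in> cube_plaquettes n i j k" "Q \<in> cube_plaquettes n i j k" "R \<in> cube_plaquettes n i j k"
  shows "aligned (coeff_point \<alpha> \<beta> \<gamma> P) (coeff_point \<alpha> \<beta> \<gamma> Q) (coeff_point \<alpha> \<beta> \<gamma> R)"
proof -
  have cubes: "lattice_cube i j k" "lattice_cube j k i" "lattice_cube k i j"
    using dist by (auto simp: lattice_cube_def)
  have ranks: "corner_rank (lagrangian \<alpha> \<beta> \<gamma>) n j k i = 2" "corner_rank (lagrangian \<alpha> \<beta> \<gamma>) n k i j = 2"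
    using rank by (metis corner_rank_rotate)+
  \<comment> \<open>Eight triples in each of three rotations cover all twenty.\<close>
  note facts = lattice_cube.aligned_coeff_points_cyclic[OF cubes(1) rank]
    lattice_cube.aligned_coeff_points_cyclic[OF cubes(2) ranks(1)]
    lattice_cube.aligned_coeff_points_cyclic[OF cubes(3) ranks(2)]
  let ?f = "coeff_point \<alpha> \<beta> \<gamma>"
  have "?f ` cube_plaquettes n i j k = {?f (n, j, k), ?f (n, k, i), ?f (n, i, j),
      ?f (n + unit_shift i, j, k), ?f (n + unit_shift j, k, i), ?f (n + unit_shift k, i, j)}"
    unfolding cube_plaquettes_def base_plaquettes_def opposite_plaquettes_def by auto
  then have "?f P \<in> {?f (n, j, k), ?f (n, k, i), ?f (n, i, j),
      ?f (n + unit_shift i, j, k), ?f (n + unit_shift j, k, i), ?f (n + unit_shift k, i, j)}"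
    if "P \<in> cube_plaquettes n i j k" for P
    using that by (metis imageI)
  note mem = this[OF assms(3)] this[OF assms(4)] this[OF assms(5)]
  show ?thesis
    by (rule aligned_six_points[OF _ _ _ _ _ _ _ _ _ _ _ _ _ _ _ _ _ _ _ _ mem])
      (fact facts | subst aligned_right_swap, fact facts)+
qed

section \<open>Normalized star-triangle parameters\<close>

lemma quadratic_rootsD:
  assumes "quadratic_roots l m r (- \<xi>) (- \<eta>)"
  shows "m = l * (\<xi> + \<eta>)" and "r = l * (\<xi> * \<eta>)"
proof -
  have eq: "l * x\<^sup>2 + m * x + r = l * (x + \<xi>) * (x + \<eta>)" for x
    using assms by (simp add: quadratic_roots_def)
  show r: "r = l * (\<xi> * \<eta>)" using eq[of 0] by simp
  show "m = l * (\<xi> + \<eta>)" using eq[of 1] r by (simp add: algebra_simps)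
qed

text \<open>With \<open>s\<close> the parity of the base point of a cube, this is
  \<open>(s / x - \<beta>) / \<alpha>\<close> on base plaquettes and
  \<open>- (s / x + \<beta>) / \<alpha>\<close> on opposite ones. Hence P and Q of the abstract cube
  are the negatives of the values on opposite plaquettes.\<close>

definition reduced_param ::
  "(int ^ 'n \<Rightarrow> 'n \<Rightarrow> 'n \<Rightarrow> 'a) \<Rightarrow> (int ^ 'n \<Rightarrow> 'n \<Rightarrow> 'n \<Rightarrow> 'a) \<Rightarrow> 'a::field \<Rightarrow>
    int ^ 'n::finite \<Rightarrow> 'n \<Rightarrow> 'n \<Rightarrow> 'a" where
  "reduced_param \<alpha> \<beta> x n i j = (parity_sign n / x - \<beta> n i j) / \<alpha> n i j"

lemma parity_sign_neq_0 [simp]: "parity_sign n \<noteq> (0 :: 'a::field)"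
  by (simp add: parity_sign_def)

lemma star_param_eq:
  "x \<noteq> 0 \<Longrightarrow> star_param \<alpha> \<beta> x n i j = parity_sign n * x * reduced_param \<alpha> \<beta> x n i j"
  by (simp add: star_param_def reduced_param_def right_diff_distrib mult.assoc[symmetric])

text \<open>As \<nu> equals \<lambda> times \<open>\<xi> * \<eta>\<close>, the factors
  \<open>s * \<xi>\<close> and \<open>s * \<eta>\<close> between the two kinds of parameters absorb
  the constant \<lambda>/\<nu>.\<close>

lemma star_triangle_at_iff:
  fixes \<alpha> \<beta> :: "int ^ 'n::finite \<Rightarrow> 'n \<Rightarrow> 'n \<Rightarrow> 'a::field" and \<xi> \<eta> :: 'a
  defines "p \<equiv> reduced_param \<alpha> \<beta> \<xi>" and "q \<equiv> reduced_param \<alpha> \<beta> \<eta>"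
  assumes "l \<noteq> 0" "\<xi> \<noteq> 0" "\<eta> \<noteq> 0" "p (n + unit_shift k) i j \<noteq> 0" "q n i j \<noteq> 0"
  shows "star_triangle_at (l / (l * (\<xi> * \<eta>))) (star_param \<alpha> \<beta> \<xi>) (star_param \<alpha> \<beta> \<eta>) n i j k \<longleftrightarrow>
    - p (n + unit_shift k) i j * (q n j k * q n k i + q n k i * q n i j + q n i j * q n j k)
      = q n i j"
proof -
  define s :: 'a where "s = parity_sign n"
  have s: "s * s = 1" "s \<noteq> 0" by (simp_all add: s_def)
  define e where "e = q n j k * q n k i + q n k i * q n i j + q n i j * q n j k"
  have star: "star_param \<alpha> \<beta> \<xi> (n + unit_shift k) i j = - s * \<xi> * p (n + unit_shift k) i j"
    "star_param \<alpha> \<beta> \<eta> n a b = s * \<eta> * q n a b" for a b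
    using assms(4,5) by (simp_all add: star_param_eq p_def q_def s_def)
  have num: "s * \<eta> * q n i j * (s * \<eta> * q n j k) + s * \<eta> * q n j k * (s * \<eta> * q n k i)
      + s * \<eta> * q n k i * (s * \<eta> * q n i j) = s * s * (\<eta> * \<eta>) * e"
    by (simp add: e_def algebra_simps)
  have "star_triangle_at (l / (l * (\<xi> * \<eta>))) (star_param \<alpha> \<beta> \<xi>) (star_param \<alpha> \<beta> \<eta>) n i j k \<longleftrightarrow>
    1 / (- s * \<xi> * p (n + unit_shift k) i j)
      = l / (l * (\<xi> * \<eta>)) * (s * s * (\<eta> * \<eta>) * e / (s * \<eta> * q n i j))"
    unfolding star_triangle_at_def star num ..
  also have "\<dots> \<longleftrightarrow> - p (n + unit_shift k) i j * e = q n i j"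
    using assms(3-) s by (simp add: field_simps) (auto simp: algebra_simps; metis minus_minus)
  finally show ?thesis unfolding e_def .
qed

text \<open>Division by \<open>l * (\<xi> * \<eta>)\<close> leaves a quadratic in \<beta> that
  factors because the squared parity sign is 1.\<close>

lemma coeff_constraint_iff_roots:
  fixes \<alpha> \<beta> \<gamma> :: "int ^ 'n::finite \<Rightarrow> 'n \<Rightarrow> 'n \<Rightarrow> 'a::field"
  assumes "l \<noteq> 0" "\<xi> \<noteq> 0" "\<eta> \<noteq> 0"
  shows "coeff_constraint \<alpha> \<beta> \<gamma> l (l * (\<xi> + \<eta>)) (l * (\<xi> * \<eta>)) (n, i, j) \<longleftrightarrow>
    \<alpha> n i j * \<gamma> n i j = (parity_sign n / \<xi> - \<beta> n i j) * (parity_sign n / \<eta> - \<beta> n i j)"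
proof -
  define s :: 'a where "s = parity_sign n"
  define x y where "x = s / \<xi>" and "y = s / \<eta>"
  have xy: "\<xi> * x = s" "\<eta> * y = s" and s: "s * s = 1" using assms by (simp_all add: x_def y_def s_def)
  have "l - l * (\<xi> + \<eta>) * s * \<beta> n i j + l * (\<xi> * \<eta>) * ((\<beta> n i j)\<^sup>2 - \<alpha> n i j * \<gamma> n i j)
    = l * (\<xi> * \<eta>) * ((x - \<beta> n i j) * (y - \<beta> n i j) - \<alpha> n i j * \<gamma> n i j)"
  proof -
    have "\<xi> * \<eta> * ((x - \<beta> n i j) * (y - \<beta> n i j)) =
      \<xi> * x * (\<eta> * y) - \<beta> n i j * (\<xi> * (\<eta> * y) + \<eta> * (\<xi> * x)) + \<xi> * \<eta> * (\<beta> n i j)\<^sup>2"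
      by (simp add: algebra_simps power2_eq_square)
    then have "\<xi> * \<eta> * ((x - \<beta> n i j) * (y - \<beta> n i j)) =
      1 - \<beta> n i j * (\<xi> * s + \<eta> * s) + \<xi> * \<eta> * (\<beta> n i j)\<^sup>2"
      by (simp only: xy s)
    then show ?thesis by algebra
  qed
  then show ?thesis
    using assms by (auto simp: coeff_constraint_def s_def x_def y_def)
qed

section \<open>Rank two versus the star-triangle relations\<close>

context lattice_cube
begin

lemma star_triangle_at_if_corner_rank:
  assumes rank: "corner_rank (lagrangian \<alpha> \<beta> \<gamma>) n i j k = 2"
    and nz: "l \<noteq> 0" "\<xi> \<noteq> 0" "\<eta> \<noteq> 0"
    and constr: "\<And>P. P \<in> cube_plaquettes n i j k \<Longrightarrow>
      coeff_constraint \<alpha> \<beta> \<gamma> l (l * (\<xi> + \<eta>)) (l * (\<xi> * \<eta>)) P \<and> nondegenerate \<alpha> \<beta> \<xi> \<eta> P"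
  shows "star_triangle_at (l / (l * (\<xi> * \<eta>))) (star_param \<alpha> \<beta> \<xi>) (star_param \<alpha> \<beta> \<eta>) n i j k"
proof -
  define x y :: 'a where "x = parity_sign n / \<xi>" and "y = parity_sign n / \<eta>"
  define q where "q = reduced_param \<alpha> \<beta> \<eta>"
  let ?m = "n + unit_shift k"
  have P: "(n, j, k) \<in> cube_plaquettes n i j k" "(n, k, i) \<in> cube_plaquettes n i j k"
    "(n, i, j) \<in> cube_plaquettes n i j k" "(?m, i, j) \<in> cube_plaquettes n i j k"
    by (simp_all add: cube_plaquettes_def base_plaquettes_def opposite_plaquettes_def)
  note roots = P[THEN constr, THEN conjunct1, unfolded coeff_constraint_iff_roots[OF nz]]
  have nondeg: "\<alpha> n j k \<noteq> 0" "\<alpha> n k i \<noteq> 0" "\<alpha> n i j \<noteq> 0" "\<alpha> ?m i j \<noteq> 0"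
    "reduced_param \<alpha> \<beta> \<xi> ?m i j \<noteq> 0" "q n i j \<noteq> 0"
    using P[THEN constr] nz by (simp_all add: nondegenerate_def star_param_eq q_def)
  \<comment> \<open>On the opposite plaquette the parity is reversed, so its constraint takes the
    form \<open>(x + B3) * (y + B3)\<close> required by \<open>star_polynomial\<close>.\<close>
  have "(\<beta> n i j - y) * \<alpha> ?m i j * \<alpha> n j k * \<alpha> n k i + (x + \<beta> ?m i j) *
    ((\<beta> n j k - y) * (\<beta> n k i - y) * \<alpha> n i j + (\<beta> n k i - y) * (\<beta> n i j - y) * \<alpha> n j k
      + (\<beta> n i j - y) * (\<beta> n j k - y) * \<alpha> n k i) = 0"
    by (rule star_polynomial[OF rank_le_two_if_corner_rank[OF rank]])
      (use roots in \<open>simp_all add: x_def y_def algebra_simps\<close>)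
  moreover have eqs: "\<beta> n j k - y = - \<alpha> n j k * q n j k" "\<beta> n k i - y = - \<alpha> n k i * q n k i"
    "\<beta> n i j - y = - \<alpha> n i j * q n i j"
    "x + \<beta> ?m i j = - \<alpha> ?m i j * reduced_param \<alpha> \<beta> \<xi> ?m i j"
    using nondeg by (simp_all add: q_def reduced_param_def x_def y_def)
  ultimately have "\<alpha> ?m i j * \<alpha> n j k * \<alpha> n k i * \<alpha> n i j *
    (- reduced_param \<alpha> \<beta> \<xi> ?m i j * (q n j k * q n k i + q n k i * q n i j + q n i j * q n j k)
      - q n i j) = 0"
    unfolding eqs by algebra
  then show ?thesis
    using nondeg nz by (subst star_triangle_at_iff) (simp_all add: q_def)
qed

lemma corner_rank_if_star_triangle:
  assumes nz: "l \<noteq> 0" "\<xi> \<noteq> 0" "\<eta> \<noteq> 0" and "\<xi> \<noteq> \<eta>"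
    and constr: "\<And>P. P \<in> cube_plaquettes n i j k \<Longrightarrow>
      coeff_constraint \<alpha> \<beta> \<gamma> l (l * (\<xi> + \<eta>)) (l * (\<xi> * \<eta>)) P \<and> nondegenerate \<alpha> \<beta> \<xi> \<eta> P"
    and star: "coupled_star_triangle (l / (l * (\<xi> * \<eta>))) (star_param \<alpha> \<beta> \<xi>) (star_param \<alpha> \<beta> \<eta>) n i j k"
  shows "corner_rank (lagrangian \<alpha> \<beta> \<gamma>) n i j k = 2"
proof -
  define x y :: 'a where "x = parity_sign n / \<xi>" and "y = parity_sign n / \<eta>"
  have "x \<noteq> y" using \<open>\<xi> \<noteq> \<eta>\<close> nz by (simp add: x_def y_def divide_simps)
  define p q where "p = reduced_param \<alpha> \<beta> \<xi>" and "q = reduced_param \<alpha> \<beta> \<eta>"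
  note plaqs = cube_plaquettes_def base_plaquettes_def opposite_plaquettes_def
  have P: "(n, j, k) \<in> cube_plaquettes n i j k" "(n, k, i) \<in> cube_plaquettes n i j k"
    "(n, i, j) \<in> cube_plaquettes n i j k" "(n + unit_shift i, j, k) \<in> cube_plaquettes n i j k"
    "(n + unit_shift j, k, i) \<in> cube_plaquettes n i j k"
    "(n + unit_shift k, i, j) \<in> cube_plaquettes n i j k"
    by (simp_all add: plaqs)
  note roots = P[THEN constr, THEN conjunct1, unfolded coeff_constraint_iff_roots[OF nz]]
  have nondeg: "\<alpha> m a b \<noteq> 0 \<and> p m a b \<noteq> 0 \<and> q m a b \<noteq> 0"
    if "(m, a, b) \<in> cube_plaquettes n i j k" for m a b
    using constr[OF that] nz by (simp add: nondegenerate_def star_param_eq p_def q_def)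
  note nd = P[THEN nondeg]
  have lin: "\<alpha> n a b * p n a b + \<beta> n a b = x" "\<alpha> n a b * q n a b + \<beta> n a b = y"
    if "\<alpha> n a b \<noteq> 0" for a b
    using that by (simp_all add: p_def q_def reduced_param_def x_def y_def)
  \<comment> \<open>The reversed parity on opposite plaquettes accounts for the minus signs.\<close>
  have lin': "\<alpha> (n + unit_shift c) a b * (- p (n + unit_shift c) a b) - \<beta> (n + unit_shift c) a b = x"
    "\<alpha> (n + unit_shift c) a b * (- q (n + unit_shift c) a b) - \<beta> (n + unit_shift c) a b = y"
    if "\<alpha> (n + unit_shift c) a b \<noteq> 0" for a b c
    using that by (simp_all add: p_def q_def reduced_param_def x_def y_def)
  have quad: "\<gamma> m a b = \<alpha> m a b * p m a b * q m a b"
    if "\<alpha> m a b * \<gamma> m a b = (parity_sign m / \<xi> - \<beta> m a b) * (parity_sign m / \<eta> - \<beta> m a b)"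
      "\<alpha> m a b \<noteq> 0" for m a b
    using that(2) by (simp add: p_def q_def reduced_param_def flip: that(1))
  note iff1 = star_triangle_at_iff[OF nz, of \<alpha> \<beta>, folded p_def q_def]
  note iff2 = star_triangle_at_iff[OF nz(1,3,2), of \<alpha> \<beta>, folded p_def q_def, unfolded mult.commute[of \<eta> \<xi>]]
  have star_q: "- p (n + unit_shift c) a b * (q n b c * q n c a + q n c a * q n a b + q n a b * q n b c) = q n a b"
    and star_p: "- q (n + unit_shift c) a b * (p n b c * p n c a + p n c a * p n a b + p n a b * p n b c) = p n a b"
    if "(a, b, c) \<in> {(i, j, k), (j, k, i), (k, i, j)}" for a b c
    using that star nd iff1[of n c a b] iff2[of n c a b] unfolding coupled_star_triangle_def by auto
  show ?thesis
  proof (rule corner_rank_eq_two)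
    \<comment> \<open>The Moutard coefficients P and Q are instantiated with the negated parameters
      on the opposite plaquettes.\<close>
    show "\<exists>s t. \<forall>U. corner v U = s * corner X3 U + t * corner Y1 U" for v
    proof (rule corner_combination[of x y "p n j k" "p n k i" "p n i j" "q n j k" "q n k i" "q n i j"
          "- p (n + unit_shift i) j k" "- p (n + unit_shift j) k i" "- p (n + unit_shift k) i j"
          "- q (n + unit_shift i) j k" "- q (n + unit_shift j) k i" "- q (n + unit_shift k) i j"])
    qed (use \<open>x \<noteq> y\<close> nd lin lin' roots[THEN quad] star_q[of j k i] star_q[of k i j] star_q[of i j k]
       star_p[of j k i] star_p[of k i j] star_p[of i j k] in \<open>simp_all add: ac_simps\<close>)
  next
    show "s = 0 \<and> t = 0" if "\<And>U. s * corner X3 U + t * corner Y1 U = 0" for s t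
      by (rule corner_independent[OF _ _ that]) (use nd roots[THEN quad] in auto)
  qed
qed

end

lemma cube_plaquettes_rotate: "cube_plaquettes n j k i = cube_plaquettes n i j k"
  unfolding cube_plaquettes_def base_plaquettes_def opposite_plaquettes_def by blast

text \<open>One star-triangle relation yields all six through cyclic rotation and the exchange of
  \<xi> and \<eta>, which preserves the constraint.\<close>

lemma coupled_star_triangle_if_corner_rank:
  fixes \<alpha> \<beta> \<gamma> :: "int ^ 'n::finite \<Rightarrow> 'n \<Rightarrow> 'n \<Rightarrow> 'a::real_normed_field"
  assumes dist: "distinct [i, j, k]" and rank: "corner_rank (lagrangian \<alpha> \<beta> \<gamma>) n i j k = 2"
    and nz: "l \<noteq> 0" "\<xi> \<noteq> 0" "\<eta> \<noteq> 0"
    and constr: "\<And>P. P \<in> cube_plaquettes n i j k \<Longrightarrow>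
      coeff_constraint \<alpha> \<beta> \<gamma> l (l * (\<xi> + \<eta>)) (l * (\<xi> * \<eta>)) P \<and> nondegenerate \<alpha> \<beta> \<xi> \<eta> P"
  shows "coupled_star_triangle (l / (l * (\<xi> * \<eta>))) (star_param \<alpha> \<beta> \<xi>) (star_param \<alpha> \<beta> \<eta>) n i j k"
proof -
  have "star_triangle_at (l / (l * (\<xi> * \<eta>))) (star_param \<alpha> \<beta> \<xi>) (star_param \<alpha> \<beta> \<eta>) n i' j' k' \<and>
      star_triangle_at (l / (l * (\<xi> * \<eta>))) (star_param \<alpha> \<beta> \<eta>) (star_param \<alpha> \<beta> \<xi>) n i' j' k'"
    if "lattice_cube i' j' k'" "corner_rank (lagrangian \<alpha> \<beta> \<gamma>) n i' j' k' = 2"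
      "cube_plaquettes n i' j' k' = cube_plaquettes n i j k" for i' j' k'
  proof
    show "star_triangle_at (l / (l * (\<xi> * \<eta>))) (star_param \<alpha> \<beta> \<xi>) (star_param \<alpha> \<beta> \<eta>) n i' j' k'"
      using lattice_cube.star_triangle_at_if_corner_rank[OF that(1,2) nz] constr
      unfolding that(3) by blast
    have "coeff_constraint \<alpha> \<beta> \<gamma> l (l * (\<eta> + \<xi>)) (l * (\<eta> * \<xi>)) P \<and> nondegenerate \<alpha> \<beta> \<eta> \<xi> P"
      if "P \<in> cube_plaquettes n i j k" for P
      using constr[OF that] by (auto simp: add.commute mult.commute nondegenerate_def)
    then show "star_triangle_at (l / (l * (\<xi> * \<eta>))) (star_param \<alpha> \<beta> \<eta>) (star_param \<alpha> \<beta> \<xi>) n i' j' k'"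
      using lattice_cube.star_triangle_at_if_corner_rank[OF that(1,2) nz(1,3,2)]
      unfolding that(3) mult.commute[of \<eta> \<xi>] by blast
  qed
  moreover have "lattice_cube i j k" "lattice_cube j k i" "lattice_cube k i j"
    using dist by (auto simp: lattice_cube_def)
  moreover have "corner_rank (lagrangian \<alpha> \<beta> \<gamma>) n j k i = 2"
    "corner_rank (lagrangian \<alpha> \<beta> \<gamma>) n k i j = 2"
    using rank by (metis corner_rank_rotate)+
  moreover have "cube_plaquettes n j k i = cube_plaquettes n i j k"
    "cube_plaquettes n k i j = cube_plaquettes n i j k"
    by (metis cube_plaquettes_rotate)+
  ultimately show ?thesis
    using rank unfolding coupled_star_triangle_def by auto
qed

theorem theorem10:
  fixes \<alpha> \<beta> \<gamma> :: "int ^ 'n::finite \<Rightarrow> 'n \<Rightarrow> 'n \<Rightarrow> 'a::real_normed_field"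
  assumes "discrete_2form (lagrangian \<alpha> \<beta> \<gamma>)"
  shows
    "(consistent (lagrangian \<alpha> \<beta> \<gamma>) \<longrightarrow>
        (\<forall>n i j k. distinct [i, j, k] \<longrightarrow>
          (\<exists>lam \<mu> \<nu>. (lam, \<mu>, \<nu>) \<noteq> (0, 0, 0) \<and>
             (\<forall>P \<in> cube_plaquettes n i j k. coeff_constraint \<alpha> \<beta> \<gamma> lam \<mu> \<nu> P)))) \<and>
     (\<forall>n i j k lam \<mu> \<nu>.
        distinct [i, j, k] \<and> corner_rank (lagrangian \<alpha> \<beta> \<gamma>) n i j k = 2 \<and>
        (\<exists>(m, a, b) \<in> base_plaquettes n i j k. \<exists>(m', a', b') \<in> base_plaquettes n i j k.
           (\<beta> m a b, \<alpha> m a b * \<gamma> m a b) \<noteq> (\<beta> m' a' b', \<alpha> m' a' b' * \<gamma> m' a' b')) \<and>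
        (\<forall>P \<in> base_plaquettes n i j k. coeff_constraint \<alpha> \<beta> \<gamma> lam \<mu> \<nu> P) \<longrightarrow>
        (\<forall>P \<in> opposite_plaquettes n i j k. coeff_constraint \<alpha> \<beta> \<gamma> lam \<mu> \<nu> P)) \<and>
     (\<forall>n i j k lam \<mu> \<nu> \<xi> \<eta>.
        distinct [i, j, k] \<and> lam \<noteq> 0 \<and> \<nu> \<noteq> 0 \<and> quadratic_roots lam \<mu> \<nu> (- \<xi>) (- \<eta>) \<and>
        (\<forall>P \<in> cube_plaquettes n i j k.
           coeff_constraint \<alpha> \<beta> \<gamma> lam \<mu> \<nu> P \<and> nondegenerate \<alpha> \<beta> \<xi> \<eta> P) \<longrightarrow>
        (corner_rank (lagrangian \<alpha> \<beta> \<gamma>) n i j k = 2 \<longrightarrow>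
           coupled_star_triangle (lam / \<nu>) (star_param \<alpha> \<beta> \<xi>) (star_param \<alpha> \<beta> \<eta>) n i j k) \<and>
        (\<xi> \<noteq> \<eta> \<and>
           coupled_star_triangle (lam / \<nu>) (star_param \<alpha> \<beta> \<xi>) (star_param \<alpha> \<beta> \<eta>) n i j k \<longrightarrow>
           corner_rank (lagrangian \<alpha> \<beta> \<gamma>) n i j k = 2)) \<and>
     (\<forall>lam \<mu> \<nu> \<xi> \<eta>.
        lam \<noteq> 0 \<and> \<nu> \<noteq> 0 \<and> quadratic_roots lam \<mu> \<nu> (- \<xi>) (- \<eta>) \<and> \<xi> \<noteq> \<eta> \<and>
        (\<forall>n i j. i \<noteq> j \<longrightarrow>
           coeff_constraint \<alpha> \<beta> \<gamma> lam \<mu> \<nu> (n, i, j) \<and> nondegenerate \<alpha> \<beta> \<xi> \<eta> (n, i, j)) \<longrightarrow>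
        (consistent (lagrangian \<alpha> \<beta> \<gamma>) \<longleftrightarrow>
           (\<forall>n i j k. distinct [i, j, k] \<longrightarrow>
              coupled_star_triangle (lam / \<nu>) (star_param \<alpha> \<beta> \<xi>) (star_param \<alpha> \<beta> \<eta>) n i j k)))"
    (is "?line \<and> ?evolution \<and> ?star \<and> ?global")
proof -
  have star: "corner_rank (lagrangian \<alpha> \<beta> \<gamma>) n i j k = 2 \<Longrightarrow>
      coupled_star_triangle (lam / \<nu>) (star_param \<alpha> \<beta> \<xi>) (star_param \<alpha> \<beta> \<eta>) n i j k"
    "\<xi> \<noteq> \<eta> \<Longrightarrow>
      coupled_star_triangle (lam / \<nu>) (star_param \<alpha> \<beta> \<xi>) (star_param \<alpha> \<beta> \<eta>) n i j k \<Longrightarrow>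
      corner_rank (lagrangian \<alpha> \<beta> \<gamma>) n i j k = 2"
    if "distinct [i, j, k]" "lam \<noteq> 0" "\<nu> \<noteq> 0"
      and roots: "quadratic_roots lam \<mu> \<nu> (- \<xi>) (- \<eta>)"
      and constr: "\<And>P. P \<in> cube_plaquettes n i j k \<Longrightarrow>
        coeff_constraint \<alpha> \<beta> \<gamma> lam \<mu> \<nu> P \<and> nondegenerate \<alpha> \<beta> \<xi> \<eta> P"
    for n i j k lam \<mu> \<nu> \<xi> \<eta>
  proof -
    note eqs = quadratic_rootsD[OF roots]
    \<comment> \<open>\<nu> is \<lambda> times \<open>\<xi> * \<eta>\<close>, so neither factor can
      vanish.\<close>
    have nz: "\<xi> \<noteq> 0" "\<eta> \<noteq> 0" using eqs \<open>\<nu> \<noteq> 0\<close> by auto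
    note constr' = constr[unfolded eqs]
    show "coupled_star_triangle (lam / \<nu>) (star_param \<alpha> \<beta> \<xi>) (star_param \<alpha> \<beta> \<eta>) n i j k"
      if "corner_rank (lagrangian \<alpha> \<beta> \<gamma>) n i j k = 2"
      unfolding eqs
      by (rule coupled_star_triangle_if_corner_rank[OF \<open>distinct [i, j, k]\<close> that \<open>lam \<noteq> 0\<close> nz constr'])
    have cube: "lattice_cube i j k" using \<open>distinct [i, j, k]\<close> by (simp add: lattice_cube_def)
    show "corner_rank (lagrangian \<alpha> \<beta> \<gamma>) n i j k = 2"
      if neq: "\<xi> \<noteq> \<eta>"
        and star: "coupled_star_triangle (lam / \<nu>) (star_param \<alpha> \<beta> \<xi>) (star_param \<alpha> \<beta> \<eta>) n i j k"
      by (rule lattice_cube.corner_rank_if_star_triangle[OF cube \<open>lam \<noteq> 0\<close> nz neq constr' star[unfolded eqs]])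
  qed
  have ?line
  proof (intro impI allI)
    fix n and i j k :: 'n
    assume "consistent (lagrangian \<alpha> \<beta> \<gamma>)" and dist: "distinct [i, j, k]"
    then have "corner_rank (lagrangian \<alpha> \<beta> \<gamma>) n i j k = 2" by (auto simp: consistent_def)
    note aligned = aligned_coeff_points[OF dist this]
    have "\<exists>l m r. (l, m, r) \<noteq> (0, 0, 0) \<and>
        (\<forall>P \<in> coeff_point \<alpha> \<beta> \<gamma> ` cube_plaquettes n i j k. l + m * fst P + r * snd P = 0)"
      by (rule aligned_imp_line) (use aligned in blast)
    then show "\<exists>lam \<mu> \<nu>. (lam, \<mu>, \<nu>) \<noteq> (0, 0, 0) \<and>
        (\<forall>P \<in> cube_plaquettes n i j k. coeff_constraint \<alpha> \<beta> \<gamma> lam \<mu> \<nu> P)"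
      unfolding coeff_constraint_iff_point by blast
  qed
  moreover have ?evolution
  proof (intro allI impI ballI, elim conjE)
    fix n i j k lam \<mu> \<nu> R
    assume dist: "distinct [i, j, k]" and rank: "corner_rank (lagrangian \<alpha> \<beta> \<gamma>) n i j k = 2"
      and "\<exists>(m, a, b) \<in> base_plaquettes n i j k. \<exists>(m', a', b') \<in> base_plaquettes n i j k.
           (\<beta> m a b, \<alpha> m a b * \<gamma> m a b) \<noteq> (\<beta> m' a' b', \<alpha> m' a' b' * \<gamma> m' a' b')"
      and base: "\<forall>P \<in> base_plaquettes n i j k. coeff_constraint \<alpha> \<beta> \<gamma> lam \<mu> \<nu> P"
      and R: "R \<in> opposite_plaquettes n i j k"
    then obtain m a b m' a' b' where PQ: "(m, a, b) \<in> base_plaquettes n i j k"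
        "(m', a', b') \<in> base_plaquettes n i j k"
      and neq: "(\<beta> m a b, \<alpha> m a b * \<gamma> m a b) \<noteq> (\<beta> m' a' b', \<alpha> m' a' b' * \<gamma> m' a' b')"
      by blast
    \<comment> \<open>Base plaquettes share one parity sign, so different coefficient data give
      different points. These two points determine the line, which must also contain the point of
      \<open>R\<close>.\<close>
    have "m = m'" using PQ by (auto simp: base_plaquettes_def)
    then have "coeff_point \<alpha> \<beta> \<gamma> (m, a, b) \<noteq> coeff_point \<alpha> \<beta> \<gamma> (m', a', b')"
      using neq by (auto simp: coeff_point_def)
    moreover have "aligned (coeff_point \<alpha> \<beta> \<gamma> (m, a, b)) (coeff_point \<alpha> \<beta> \<gamma> (m', a', b'))
        (coeff_point \<alpha> \<beta> \<gamma> R)"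
      by (rule aligned_coeff_points[OF dist rank]) (use PQ R in \<open>auto simp: cube_plaquettes_def\<close>)
    ultimately show "coeff_constraint \<alpha> \<beta> \<gamma> lam \<mu> \<nu> R"
      using base PQ unfolding coeff_constraint_iff_point by (blast intro: aligned_on_line)
  qed
  moreover have ?star
    using star by blast
  moreover have ?global
  proof (intro allI impI, elim conjE)
    fix lam \<mu> \<nu> \<xi> \<eta>
    assume *: "lam \<noteq> 0" "\<nu> \<noteq> 0" "quadratic_roots lam \<mu> \<nu> (- \<xi>) (- \<eta>)" "\<xi> \<noteq> \<eta>"
      and constr: "\<forall>n i j. i \<noteq> j \<longrightarrow>
        coeff_constraint \<alpha> \<beta> \<gamma> lam \<mu> \<nu> (n, i, j) \<and> nondegenerate \<alpha> \<beta> \<xi> \<eta> (n, i, j)"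
    have all: "coeff_constraint \<alpha> \<beta> \<gamma> lam \<mu> \<nu> P \<and> nondegenerate \<alpha> \<beta> \<xi> \<eta> P"
      if "distinct [i, j, k]" "P \<in> cube_plaquettes n i j k" for n i j k P
      using that constr
      by (auto simp: cube_plaquettes_def base_plaquettes_def opposite_plaquettes_def)
    have "corner_rank (lagrangian \<alpha> \<beta> \<gamma>) n i j k = 2 \<longleftrightarrow>
        coupled_star_triangle (lam / \<nu>) (star_param \<alpha> \<beta> \<xi>) (star_param \<alpha> \<beta> \<eta>) n i j k"
      if "distinct [i, j, k]" for n i j k
      using star[OF that *(1-3) all[OF that, where n = n]] *(4) by blast
    then show "consistent (lagrangian \<alpha> \<beta> \<gamma>) \<longleftrightarrow> (\<forall>n i j k. distinct [i, j, k] \<longrightarrow>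
        coupled_star_triangle (lam / \<nu>) (star_param \<alpha> \<beta> \<xi>) (star_param \<alpha> \<beta> \<eta>) n i j k)"
      unfolding consistent_def by blast
  qed
  ultimately show ?thesis by blast
qed

end
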